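(* For every natural number $n \geq 1$, the predicate $\mathit{Sk}_n(\psi)$ is not recursive.
   Context: We work in first-order predicate calculus with identity $\doteq$, over a language with countably many variables and countably infinitely many function symbols (constants being $0$-ary function symbols) and predicate symbols of every arity. Terms are variable-free; $\models \theta$ means that $\theta$ is true in every structure. Syntactic objects are coded by natural numbers in a standard way, so predicates of formulas are predicates of natural numbers (recursive, r.e., etc.). Among the constants an infinite set of distinguished constants, called unknowns, is singled out. For a quantifier-free formula $\phi(\bar\ast)$ whose unknowns are among $\bar\ast$, a sequence $\bar a$ of terms containing no unknowns is a solution if $\models \phi(\bar a)$ (simultaneous replacement of the unknowns by the terms); $\phi$ is solvable if it has a solution. An existential formula is a closed formula $\exists \bar x\, \phi(\bar x)$ with $\phi$ quantifier-free and containing no unknowns. A Herbrand skeleton of size $n$ of it is a formula $\phi(\bar\ast_1)\vee\cdots\vee\phi(\bar\ast_n)$, where the $\bar\ast_i$ are sequences of unknowns (each of the length of $\bar x$), all unknowns in them pairwise distinct. $\mathit{Sk}_n(\psi)$ holds iff $\psi$ is an existential formula having a solvable skeleton of size $n$ (whether one skeleton of size $n$ is solvable does not depend on the choice of unknowns). *)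

theory Defs
  imports Main "HOL-Library.Nat_Bijection" "HOL-Library.Countable_Set"
begin

section \<open>Syntax\<close>

text \<open>
  A function (predicate) symbol is determined by an index together with the number of
  arguments it is applied to, so there are countably infinitely many symbols of every arity
  and no well-formedness condition is needed.  Constants are the 0-ary function symbols.
\<close>

datatype tm = Var nat | Fun nat "tm list"

abbreviation Const :: "nat \<Rightarrow> tm" where
  "Const c \<equiv> Fun c []"

datatype fm =
    Pred nat "tm list"
  | Eql tm tm
  | Neg fm
  | Conj fm fm
  | Disj fm fm
  | Impl fm fm
  | All nat fm
  | Exi nat fm

primrec vars_tm :: "tm \<Rightarrow> nat set" where
  "vars_tm (Var x) = {x}"
| "vars_tm (Fun i ts) = \<Union> (set (map vars_tm ts))"

primrec free_vars :: "fm \<Rightarrow> nat set" where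
  "free_vars (Pred p ts) = \<Union> (set (map vars_tm ts))"
| "free_vars (Eql s t) = vars_tm s \<union> vars_tm t"
| "free_vars (Neg A) = free_vars A"
| "free_vars (Conj A B) = free_vars A \<union> free_vars B"
| "free_vars (Disj A B) = free_vars A \<union> free_vars B"
| "free_vars (Impl A B) = free_vars A \<union> free_vars B"
| "free_vars (All x A) = free_vars A - {x}"
| "free_vars (Exi x A) = free_vars A - {x}"

primrec qfree :: "fm \<Rightarrow> bool" where
  "qfree (Pred p ts) = True"
| "qfree (Eql s t) = True"
| "qfree (Neg A) = qfree A"
| "qfree (Conj A B) = (qfree A \<and> qfree B)"
| "qfree (Disj A B) = (qfree A \<and> qfree B)"
| "qfree (Impl A B) = (qfree A \<and> qfree B)"
| "qfree (All x A) = False"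
| "qfree (Exi x A) = False"

text \<open>
  \<^term>\<open>subst \<sigma>\<close> replaces free variables.  It is only ever applied to quantifier-free formulas
  with variable-free terms in the range of \<open>\<sigma>\<close>, so no renaming of bound variables is needed.
\<close>

primrec subst_tm :: "(nat \<Rightarrow> tm) \<Rightarrow> tm \<Rightarrow> tm" where
  "subst_tm \<sigma> (Var x) = \<sigma> x"
| "subst_tm \<sigma> (Fun i ts) = Fun i (map (subst_tm \<sigma>) ts)"

primrec subst :: "(nat \<Rightarrow> tm) \<Rightarrow> fm \<Rightarrow> fm" where
  "subst \<sigma> (Pred p ts) = Pred p (map (subst_tm \<sigma>) ts)"
| "subst \<sigma> (Eql s t) = Eql (subst_tm \<sigma> s) (subst_tm \<sigma> t)"
| "subst \<sigma> (Neg A) = Neg (subst \<sigma> A)"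
| "subst \<sigma> (Conj A B) = Conj (subst \<sigma> A) (subst \<sigma> B)"
| "subst \<sigma> (Disj A B) = Disj (subst \<sigma> A) (subst \<sigma> B)"
| "subst \<sigma> (Impl A B) = Impl (subst \<sigma> A) (subst \<sigma> B)"
| "subst \<sigma> (All x A) = All x (subst (\<sigma>(x := Var x)) A)"
| "subst \<sigma> (Exi x A) = Exi x (subst (\<sigma>(x := Var x)) A)"


section \<open>Semantics\<close>

record 'a fo_structure =
  Dom :: "'a set"
  FunI :: "nat \<Rightarrow> 'a list \<Rightarrow> 'a"
  PredI :: "nat \<Rightarrow> 'a list \<Rightarrow> bool"

definition is_structure :: "'a fo_structure \<Rightarrow> bool" where
  "is_structure M \<longleftrightarrow>
     Dom M \<noteq> {} \<and> (\<forall>i as. set as \<subseteq> Dom M \<longrightarrow> FunI M i as \<in> Dom M)"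

primrec val :: "'a fo_structure \<Rightarrow> (nat \<Rightarrow> 'a) \<Rightarrow> tm \<Rightarrow> 'a" where
  "val M e (Var x) = e x"
| "val M e (Fun i ts) = FunI M i (map (val M e) ts)"

primrec sat :: "'a fo_structure \<Rightarrow> (nat \<Rightarrow> 'a) \<Rightarrow> fm \<Rightarrow> bool" where
  "sat M e (Pred p ts) = PredI M p (map (val M e) ts)"
| "sat M e (Eql s t) = (val M e s = val M e t)"
| "sat M e (Neg A) = (\<not> sat M e A)"
| "sat M e (Conj A B) = (sat M e A \<and> sat M e B)"
| "sat M e (Disj A B) = (sat M e A \<or> sat M e B)"
| "sat M e (Impl A B) = (sat M e A \<longrightarrow> sat M e B)"
| "sat M e (All x A) = (\<forall>a\<in>Dom M. sat M (e(x := a)) A)"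
| "sat M e (Exi x A) = (\<exists>a\<in>Dom M. sat M (e(x := a)) A)"

text \<open>
  Truth in all structures whose domain is a nonempty subset of the type \<open>'a\<close>.  Types cannot be
  quantified inside a formula, hence the type argument.  For infinite \<open>'a\<close> this is truth in
  all structures whatsoever; lemma \<open>valid_adequate\<close> below proves it for quantifier-free formulas,
  the only ones whose validity matters for solvability.
\<close>

definition valid :: "'a itself \<Rightarrow> fm \<Rightarrow> bool" where
  "valid _ A \<longleftrightarrow>
     (\<forall>(M :: 'a fo_structure) e. is_structure M \<and> range e \<subseteq> Dom M \<longrightarrow> sat M e A)"


section \<open>Unknowns, solutions and skeletons\<close>

text \<open>The unknowns are the constants \<^term>\<open>Const u\<close> with \<open>u \<in> U\<close>, for a set \<open>U\<close> of indices.\<close>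

primrec unknowns_tm :: "nat set \<Rightarrow> tm \<Rightarrow> nat set" where
  "unknowns_tm U (Var x) = {}"
| "unknowns_tm U (Fun i ts) =
     (if ts = [] \<and> i \<in> U then {i} else \<Union> (set (map (unknowns_tm U) ts)))"

primrec unknowns :: "nat set \<Rightarrow> fm \<Rightarrow> nat set" where
  "unknowns U (Pred p ts) = \<Union> (set (map (unknowns_tm U) ts))"
| "unknowns U (Eql s t) = unknowns_tm U s \<union> unknowns_tm U t"
| "unknowns U (Neg A) = unknowns U A"
| "unknowns U (Conj A B) = unknowns U A \<union> unknowns U B"
| "unknowns U (Disj A B) = unknowns U A \<union> unknowns U B"
| "unknowns U (Impl A B) = unknowns U A \<union> unknowns U B"
| "unknowns U (All x A) = unknowns U A"
| "unknowns U (Exi x A) = unknowns U A"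

primrec replace_tm :: "nat set \<Rightarrow> (nat \<Rightarrow> tm) \<Rightarrow> tm \<Rightarrow> tm" where
  "replace_tm U \<sigma> (Var x) = Var x"
| "replace_tm U \<sigma> (Fun i ts) =
     (if ts = [] \<and> i \<in> U then \<sigma> i else Fun i (map (replace_tm U \<sigma>) ts))"

primrec replace :: "nat set \<Rightarrow> (nat \<Rightarrow> tm) \<Rightarrow> fm \<Rightarrow> fm" where
  "replace U \<sigma> (Pred p ts) = Pred p (map (replace_tm U \<sigma>) ts)"
| "replace U \<sigma> (Eql s t) = Eql (replace_tm U \<sigma> s) (replace_tm U \<sigma> t)"
| "replace U \<sigma> (Neg A) = Neg (replace U \<sigma> A)"
| "replace U \<sigma> (Conj A B) = Conj (replace U \<sigma> A) (replace U \<sigma> B)"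
| "replace U \<sigma> (Disj A B) = Disj (replace U \<sigma> A) (replace U \<sigma> B)"
| "replace U \<sigma> (Impl A B) = Impl (replace U \<sigma> A) (replace U \<sigma> B)"
| "replace U \<sigma> (All x A) = All x (replace U \<sigma> A)"
| "replace U \<sigma> (Exi x A) = Exi x (replace U \<sigma> A)"

definition solution :: "'a itself \<Rightarrow> nat set \<Rightarrow> fm \<Rightarrow> (nat \<Rightarrow> tm) \<Rightarrow> bool" where
  "solution T U A \<sigma> \<longleftrightarrow>
     (\<forall>u \<in> unknowns U A. vars_tm (\<sigma> u) = {} \<and> unknowns_tm U (\<sigma> u) = {}) \<and>
     valid T (replace U \<sigma> A)"

definition solvable :: "'a itself \<Rightarrow> nat set \<Rightarrow> fm \<Rightarrow> bool" where
  "solvable T U A \<longleftrightarrow> qfree A \<and> (\<exists>\<sigma>. solution T U A \<sigma>)"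

text \<open>\<open>\<psi> = \<exists>xs. A\<close> is an existential formula with quantifier-free matrix \<open>A\<close>.\<close>

definition existential :: "nat set \<Rightarrow> nat list \<Rightarrow> fm \<Rightarrow> fm \<Rightarrow> bool" where
  "existential U xs A \<psi> \<longleftrightarrow>
     \<psi> = foldr Exi xs A \<and> distinct xs \<and> qfree A \<and> free_vars \<psi> = {} \<and> unknowns U A = {}"

definition instantiate :: "nat list \<Rightarrow> nat list \<Rightarrow> fm \<Rightarrow> fm" where
  "instantiate xs us A =
     subst (\<lambda>x. case map_of (zip xs us) x of Some u \<Rightarrow> Const u | None \<Rightarrow> Var x) A"

text \<open>The disjunction of a nonempty list; the value on the empty list is left unspecified.\<close>

fun disjunction :: "fm list \<Rightarrow> fm" where
  "disjunction [A] = A"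
| "disjunction (A # B # As) = Disj A (disjunction (B # As))"

definition skeleton :: "nat set \<Rightarrow> nat \<Rightarrow> nat list \<Rightarrow> fm \<Rightarrow> fm \<Rightarrow> bool" where
  "skeleton U n xs A S \<longleftrightarrow>
     (\<exists>uss. length uss = n \<and> (\<forall>us \<in> set uss. length us = length xs) \<and>
        distinct (concat uss) \<and> set (concat uss) \<subseteq> U \<and>
        S = disjunction (map (\<lambda>us. instantiate xs us A) uss))"

definition Sk :: "'a itself \<Rightarrow> nat set \<Rightarrow> nat \<Rightarrow> fm \<Rightarrow> bool" where
  "Sk T U n \<psi> \<longleftrightarrow>
     (\<exists>xs A S. existential U xs A \<psi> \<and> skeleton U n xs A S \<and> solvable T U S)"


section \<open>Coding of formulas\<close>

primrec code_tm :: "tm \<Rightarrow> nat" where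
  "code_tm (Var x) = prod_encode (0, x)"
| "code_tm (Fun i ts) = prod_encode (1, prod_encode (i, list_encode (map code_tm ts)))"

primrec code_fm :: "fm \<Rightarrow> nat" where
  "code_fm (Pred p ts) = prod_encode (0, prod_encode (p, list_encode (map code_tm ts)))"
| "code_fm (Eql s t) = prod_encode (1, prod_encode (code_tm s, code_tm t))"
| "code_fm (Neg A) = prod_encode (2, code_fm A)"
| "code_fm (Conj A B) = prod_encode (3, prod_encode (code_fm A, code_fm B))"
| "code_fm (Disj A B) = prod_encode (4, prod_encode (code_fm A, code_fm B))"
| "code_fm (Impl A B) = prod_encode (5, prod_encode (code_fm A, code_fm B))"
| "code_fm (All x A) = prod_encode (6, prod_encode (x, code_fm A))"
| "code_fm (Exi x A) = prod_encode (7, prod_encode (x, code_fm A))"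


section \<open>Recursive functions and predicates\<close>

text \<open>
  \<open>recursive_fun k f\<close>: the restriction of \<open>f\<close> to lists of length \<open>k\<close> is a total recursive
  function of \<open>k\<close> arguments.  Minimisation is applied to regular functions only.  The values
  of \<open>f\<close> on lists of other lengths are irrelevant.
\<close>

inductive recursive_fun :: "nat \<Rightarrow> (nat list \<Rightarrow> nat) \<Rightarrow> bool" where
  zero: "recursive_fun k (\<lambda>xs. 0)"
| succ: "recursive_fun 1 (\<lambda>xs. Suc (xs ! 0))"
| proj: "i < k \<Longrightarrow> recursive_fun k (\<lambda>xs. xs ! i)"
| comp: "recursive_fun (length gs) f \<Longrightarrow> (\<forall>g \<in> set gs. recursive_fun k g) \<Longrightarrow>
    recursive_fun k (\<lambda>xs. f (map (\<lambda>g. g xs) gs))"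
| prec: "recursive_fun k f \<Longrightarrow> recursive_fun (Suc (Suc k)) g \<Longrightarrow>
    recursive_fun (Suc k) (\<lambda>xs. rec_nat (f (tl xs)) (\<lambda>m r. g (m # r # tl xs)) (hd xs))"
| mini: "recursive_fun (Suc k) f \<Longrightarrow> (\<forall>xs. length xs = k \<longrightarrow> (\<exists>m. f (m # xs) = 0)) \<Longrightarrow>
    recursive_fun k (\<lambda>xs. LEAST m. f (m # xs) = 0)"

definition recursive_pred :: "(nat \<Rightarrow> bool) \<Rightarrow> bool" where
  "recursive_pred P \<longleftrightarrow>
     (\<exists>f. recursive_fun 1 f \<and> (\<forall>m. f [m] = (if P m then 1 else 0)))"

definition recursive_fm_pred :: "(fm \<Rightarrow> bool) \<Rightarrow> bool" where
  "recursive_fm_pred P \<longleftrightarrow> recursive_pred (\<lambda>m. \<exists>A. m = code_fm A \<and> P A)"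


section \<open>Adequacy of the coding and of validity\<close>

lemma code_tm_inj: "code_tm s = code_tm t \<Longrightarrow> s = t"
proof (induction s arbitrary: t)
  case (Var x)
  then show ?case by (cases t) auto
next
  case (Fun i ss)
  then obtain ts where t: "t = Fun i ts" and eq: "map code_tm ss = map code_tm ts"
    by (cases t) (auto dest: inj_onD[OF inj_list_encode])
  have "ss = ts"
  proof (rule nth_equalityI)
    show len: "length ss = length ts" using eq by (metis length_map)
    fix j assume j: "j < length ss"
    then have "code_tm (ss ! j) = code_tm (ts ! j)"
      using eq len by (metis nth_map)
    with j show "ss ! j = ts ! j" by (intro Fun.IH) auto
  qed
  with t show ?case by simp
qed

lemma map_code_tm_inj: "map code_tm ss = map code_tm ts \<Longrightarrow> ss = ts"
  by (rule list.inj_map_strong[of ss ts code_tm code_tm]) (auto dest: code_tm_inj)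

lemma code_fm_inj: "code_fm A = code_fm B \<Longrightarrow> A = B"
proof (induction A arbitrary: B)
  case (Pred p ts)
  then show ?case
    by (cases B) (auto dest: inj_onD[OF inj_list_encode] map_code_tm_inj)
next
  case (Eql s t) then show ?case by (cases B) (auto dest: code_tm_inj)
next
  case (Neg A) then show ?case by (cases B) auto
next
  case (Conj A1 A2) then show ?case by (cases B) auto
next
  case (Disj A1 A2) then show ?case by (cases B) auto
next
  case (Impl A1 A2) then show ?case by (cases B) auto
next
  case (All x A) then show ?case by (cases B) auto
next
  case (Exi x A) then show ?case by (cases B) auto
qed

lemma valid_adequate:
  fixes M :: "'b fo_structure"
  assumes inf: "infinite (UNIV :: 'a set)" and val: "valid TYPE('a) A" and qf: "qfree A"
    and M: "is_structure M" and e: "range e \<subseteq> Dom M"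
  shows "sat M e A"
proof -
  define H where "H = range (val M e)"
  have "countable H"
    unfolding H_def by (intro countable_image countableI[of code_tm] inj_onI code_tm_inj)
  then obtain f :: "'b \<Rightarrow> nat" where f: "inj_on f H" by (auto simp: countable_def)
  obtain g :: "nat \<Rightarrow> 'a" where g: "inj g"
    using inf infinite_countable_subset by blast
  define h where "h = g \<circ> f"
  have h: "inj_on h H" unfolding h_def using f g by (meson comp_inj_on inj_on_subset subset_UNIV)
  define k where "k = inv_into H h"
  have kh: "k (h b) = b" if "b \<in> H" for b unfolding k_def using h that by simp
  define N where "N = \<lparr>Dom = h ` H, FunI = (\<lambda>i as. h (FunI M i (map k as))),
                       PredI = (\<lambda>p as. PredI M p (map k as))\<rparr>"
  have N: "FunI N i as = h (FunI M i (map k as))" "PredI N p as = PredI M p (map k as)" for i p as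
    by (simp_all add: N_def)
  define e' where "e' = (\<lambda>x. h (e x))"
  have HF: "FunI M i bs \<in> H" if bs: "set bs \<subseteq> H" for i bs
  proof -
    have "\<exists>ts. bs = map (val M e) ts"
      using bs unfolding H_def by (metis ex_map_conv rangeE subsetD)
    then obtain ts where "bs = map (val M e) ts" by blast
    then have "FunI M i bs = val M e (Fun i ts)" by simp
    then show ?thesis unfolding H_def by blast
  qed
  have "is_structure N"
    unfolding is_structure_def
  proof (intro conjI allI impI)
    show "Dom N \<noteq> {}" by (simp add: N_def H_def)
    fix i as assume "set as \<subseteq> Dom N"
    then have "set (map k as) \<subseteq> H" using kh by (auto simp: N_def)
    then show "FunI N i as \<in> Dom N" using HF by (simp add: N_def)
  qed
  moreover have "range e' \<subseteq> Dom N"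
  proof -
    have "e x \<in> H" for x unfolding H_def by (metis rangeI val.simps(1))
    then show ?thesis by (auto simp: N_def e'_def)
  qed
  ultimately have satN: "sat N e' A" using val unfolding valid_def by blast
  have kv: "k (h (val M e t)) = val M e t" for t by (rule kh) (simp add: H_def)
  have v: "val N e' t = h (val M e t)" for t
  proof (induction t)
    case (Fun i ts)
    then have "map k (map (val N e') ts) = map (val M e) ts"
      by (simp add: kv)
    then show ?case by (simp add: N del: map_map)
  qed (simp add: e'_def)
  have "sat N e' B = sat M e B" if "qfree B" for B
    using that
  proof (induction B)
    case (Pred p ts)
    have "map k (map (val N e') ts) = map (val M e) ts" using kv v by simp
    then show ?case by (simp add: N del: map_map)
  next
    case (Eql s t)
    show ?case using kv v by (metis sat.simps(2))
  qed auto
  with satN qf show ?thesis by blast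
qed

end

theory Submission
  imports Defs
begin

text \<open>
  Every recursive function is computed by a counter machine, and acceptance by a counter machine
  is expressed by solvability of a quantifier-free formula through shifted pairing: one unknown
  is a list of steps, each written once with special constants that mark the change of state and
  the active register.  Equations that replace these constants by their old, respectively new,
  values turn this list into the list of configurations of the run without its last, respectively
  first, member; the second unknown is the whole list.  Well-formedness of both lists is a further
  rigid equation, under a ground system of equations that acts as a tree automaton.

  For skeletons of size \<open>n\<close> the constraints are repeated in \<open>n\<close> disjoint signatures.  If the machine
  does not accept, then the \<open>l\<close>-th instance violates a constraint of the \<open>l\<close>-th copy in some structure
  in which the symbols of the other copies are trivial, and the product of these structures
  refutes all \<open>n\<close> instances at once.

  If \<open>Sk\<^sub>n\<close> were recursive, then some machine would accept the code \<open>a\<close> of a matrix exactly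
  if the formula stating acceptance of \<open>a\<close> with this matrix has no solvable skeleton of size \<open>n\<close>.
  Its own matrix gives a contradiction.
\<close>

section \<open>Closure properties of recursive functions\<close>

lemma recursive_fun_comp1:
  assumes "recursive_fun 1 f" "recursive_fun k g"
  shows "recursive_fun k (\<lambda>xs. f [g xs])"
  using recursive_fun.comp[of "[g]" f k] assms by simp

lemma recursive_fun_comp2:
  assumes "recursive_fun 2 f" "recursive_fun k g" "recursive_fun k h"
  shows "recursive_fun k (\<lambda>xs. f [g xs, h xs])"
  using recursive_fun.comp[of "[g, h]" f k] assms by (simp add: numeral_2_eq_2)

lemma recursive_fun_Suc: "recursive_fun k g \<Longrightarrow> recursive_fun k (\<lambda>xs. Suc (g xs))"
  using recursive_fun_comp1[OF recursive_fun.succ] by simp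

lemma recursive_fun_const: "recursive_fun k (\<lambda>_. m)"
  by (induction m) (auto intro: recursive_fun.zero recursive_fun_Suc)

text \<open>Primitive recursion without parameters, moved to an arbitrary argument function;
  triangle numbers and the codes of numerals are computed this way.\<close>

lemma recursive_fun_iterate:
  assumes "recursive_fun 2 s" "recursive_fun k g"
  shows "recursive_fun k (\<lambda>xs. rec_nat a (\<lambda>m r. s [m, r]) (g xs))"
proof -
  have "recursive_fun (Suc (Suc 0)) (\<lambda>xs. s [xs ! 0, xs ! 1])"
    by (rule recursive_fun_comp2[OF assms(1)]) (auto intro: recursive_fun.proj)
  from recursive_fun.prec[OF recursive_fun_const[of 0 a] this]
  have "recursive_fun 1 (\<lambda>xs. rec_nat a (\<lambda>m r. s [m, r]) (hd xs))" by simp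
  from recursive_fun_comp1[OF this assms(2)] show ?thesis by simp
qed

lemma recursive_fun_add:
  assumes "recursive_fun k g" "recursive_fun k h"
  shows "recursive_fun k (\<lambda>xs. g xs + h xs)"
proof -
  have "recursive_fun (Suc (Suc 1)) (\<lambda>xs. Suc (xs ! 1))"
    by (intro recursive_fun_Suc recursive_fun.proj) simp
  from recursive_fun.prec[OF recursive_fun.proj[of 0 1] this]
  have "recursive_fun 2 (\<lambda>xs. rec_nat (tl xs ! 0) (\<lambda>m r. Suc r) (hd xs))"
    by (simp add: numeral_2_eq_2)
  moreover have "rec_nat b (\<lambda>m r. Suc r) a = a + b" for a b :: nat
    by (induction a) auto
  ultimately show ?thesis using recursive_fun_comp2 assms by fastforce
qed

lemma recursive_fun_triangle:
  assumes "recursive_fun k g"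
  shows "recursive_fun k (\<lambda>xs. triangle (g xs))"
proof -
  have "recursive_fun 2 (\<lambda>xs. xs ! 1 + Suc (xs ! 0))"
    by (intro recursive_fun_add recursive_fun_Suc recursive_fun.proj) auto
  from recursive_fun_iterate[OF this assms, of 0]
  have "recursive_fun k (\<lambda>xs. rec_nat 0 (\<lambda>m r. r + Suc m) (g xs))" by simp
  moreover have "rec_nat 0 (\<lambda>m r. r + Suc m) a = triangle a" for a
    by (induction a) auto
  ultimately show ?thesis by simp
qed

lemma recursive_fun_prod_encode:
  assumes "recursive_fun k g" "recursive_fun k h"
  shows "recursive_fun k (\<lambda>xs. prod_encode (g xs, h xs))"
  unfolding prod_encode_def using assms
  by (auto intro!: recursive_fun_add recursive_fun_triangle)

section \<open>Compiling recursive functions to counter programs\<close>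

text \<open>\<open>While r B\<close> stands for ``while register \<open>r\<close> is positive, decrement it and execute \<open>B\<close>''.\<close>

datatype instr = Inc nat | While nat "instr list"

instance instr :: countable by countable_datatype

text \<open>The program still to be executed serves as the control state, which
  \<open>to_nat\<close> later turns into a number. Entering a loop puts its body in front of the
  loop itself.\<close>

inductive pstep :: "instr list \<times> (nat \<Rightarrow> nat) \<Rightarrow> instr list \<times> (nat \<Rightarrow> nat) \<Rightarrow> bool" where
  pstep_Inc: "pstep (Inc r # k, s) (k, s(r := Suc (s r)))"
| pstep_enter: "s r = Suc v \<Longrightarrow> pstep (While r B # k, s) (B @ While r B # k, s(r := v))"
| pstep_exit: "s r = 0 \<Longrightarrow> pstep (While r B # k, s) (k, s)"

inductive_cases pstep_IncE: "pstep (Inc r # k, s) x"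
inductive_cases pstep_WhileE: "pstep (While r B # k, s) x"
inductive_cases pstep_NilE: "pstep ([], s) x"

lemma pstep_deterministic: "pstep x y \<Longrightarrow> pstep x z \<Longrightarrow> y = z"
  by (induction rule: pstep.induct) (auto elim: pstep_IncE pstep_WhileE)

lemma pstep_result_unique:
  assumes "pstep\<^sup>*\<^sup>* x ([], s)" "pstep\<^sup>*\<^sup>* x ([], s')"
  shows "s = s'"
  using assms
proof (induction rule: converse_rtranclp_induct)
  case base
  then show ?case by (auto elim: converse_rtranclpE pstep_NilE)
next
  case (step y z)
  from step.prems show ?case
  proof (cases rule: converse_rtranclpE)
    case base
    with step.hyps(1) show ?thesis by (auto elim: pstep_NilE)
  next
    case (step z')
    with step.IH step.hyps(1) show ?thesis by (metis pstep_deterministic)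
  qed
qed

text \<open>Quantifying over every continuation \<open>k\<close> is what makes execution compose
  under \<open>@\<close> and inside loop bodies.\<close>

definition runs :: "instr list \<Rightarrow> (nat \<Rightarrow> nat) \<Rightarrow> (nat \<Rightarrow> nat) \<Rightarrow> bool" where
  "runs P s s' \<longleftrightarrow> (\<forall>k. pstep\<^sup>*\<^sup>* (P @ k, s) (k, s'))"

lemma runs_Nil: "runs [] s s"
  by (simp add: runs_def)

lemma runs_append: "runs P s s' \<Longrightarrow> runs Q s' s'' \<Longrightarrow> runs (P @ Q) s s''"
  unfolding runs_def by (metis append_assoc rtranclp_trans)

lemma runs_Inc: "runs [Inc r] s (s(r := Suc (s r)))"
  unfolding runs_def by (auto intro: pstep_Inc)

lemma runs_exit: "s r = 0 \<Longrightarrow> runs [While r B] s s"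
  unfolding runs_def by (auto intro: pstep_exit)

lemma runs_enter:
  assumes "s r = Suc v" "runs B (s(r := v)) s'" "runs [While r B] s' s''"
  shows "runs [While r B] s s''"
  unfolding runs_def
proof
  fix k
  have "pstep ([While r B] @ k, s) (B @ While r B # k, s(r := v))"
    using assms(1) by (auto intro: pstep_enter)
  moreover have "pstep\<^sup>*\<^sup>* (B @ While r B # k, s(r := v)) ([While r B] @ k, s')"
    using assms(2) unfolding runs_def by simp
  moreover have "pstep\<^sup>*\<^sup>* ([While r B] @ k, s') (k, s'')"
    using assms(3) unfolding runs_def by blast
  ultimately show "pstep\<^sup>*\<^sup>* ([While r B] @ k, s) (k, s'')"
    by (meson converse_rtranclp_into_rtranclp rtranclp_trans)
qed

section \<open>Clearing, moving and copying registers\<close>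

lemma runs_clear: "runs [While r []] s (s(r := 0))"
proof (induction "s r" arbitrary: s)
  case 0
  then have "s(r := 0) = s" by auto
  with 0 show ?case using runs_exit[of s r] by simp
next
  case (Suc v)
  then have "runs [While r []] (s(r := v)) (s(r := 0))"
    using Suc.hyps(1)[of "s(r := v)"] by simp
  with Suc show ?case using runs_enter[of s r v] runs_Nil by metis
qed

lemma runs_clear_list: "\<exists>P. \<forall>s. runs P s (\<lambda>r. if r \<in> set rs then 0 else s r)"
proof (induction rs)
  case Nil
  show ?case using runs_Nil by (intro exI[of _ "[]"]) simp
next
  case (Cons a rs)
  then obtain P where P: "\<And>s. runs P s (\<lambda>r. if r \<in> set rs then 0 else s r)" by blast
  show ?case
  proof (intro exI allI)
    fix s :: "nat \<Rightarrow> nat"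
    have "(\<lambda>r. if r \<in> set rs then 0 else (s(a := 0)) r) = (\<lambda>r. if r \<in> set (a # rs) then 0 else s r)"
      by auto
    then show "runs ([While a []] @ P) s (\<lambda>r. if r \<in> set (a # rs) then 0 else s r)"
      using runs_append[OF runs_clear P[of "s(a := 0)"]] by simp
  qed
qed

lemma runs_move:
  assumes "a \<noteq> b"
  shows "runs [While a [Inc b]] s (s(b := s b + s a, a := 0))"
proof (induction "s a" arbitrary: s)
  case 0
  then have "s(b := s b + s a, a := 0) = s" by auto
  with 0 show ?case using runs_exit[of s a] by simp
next
  case (Suc v)
  let ?s = "s(a := v, b := Suc (s b))"
  have 1: "runs [Inc b] (s(a := v)) ?s"
    using runs_Inc[of b "s(a := v)"] assms by simp
  have "?s(b := ?s b + ?s a, a := 0) = s(b := s b + s a, a := 0)"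
    using assms Suc.hyps(2)[symmetric] by (auto simp: fun_eq_iff)
  then have 2: "runs [While a [Inc b]] ?s (s(b := s b + s a, a := 0))"
    using Suc.hyps(1)[of ?s] assms by simp
  show ?case using runs_enter[OF Suc.hyps(2)[symmetric] 1 2] .
qed

lemma runs_split:
  assumes "a \<noteq> b" "a \<noteq> t" "b \<noteq> t"
  shows "runs [While a [Inc b, Inc t]] s (s(b := s b + s a, t := s t + s a, a := 0))"
proof (induction "s a" arbitrary: s)
  case 0
  then have "s(b := s b + s a, t := s t + s a, a := 0) = s" by auto
  with 0 show ?case using runs_exit[of s a] by simp
next
  case (Suc v)
  let ?s = "s(a := v, b := Suc (s b), t := Suc (s t))"
  have 1: "runs ([Inc b] @ [Inc t]) (s(a := v)) ?s"
    using runs_append[OF runs_Inc[of b "s(a := v)"] runs_Inc[of t]] assms by simp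
  have "?s(b := ?s b + ?s a, t := ?s t + ?s a, a := 0) = s(b := s b + s a, t := s t + s a, a := 0)"
    using assms Suc.hyps(2)[symmetric] by (auto simp: fun_eq_iff)
  then have 2: "runs [While a [Inc b, Inc t]] ?s (s(b := s b + s a, t := s t + s a, a := 0))"
    using Suc.hyps(1)[of ?s] assms by simp
  show ?case using runs_enter[OF Suc.hyps(2)[symmetric] 1[simplified] 2] .
qed

text \<open>Reading a register destroys it, so its content goes to \<open>b\<close> and to the
  scratch register \<open>t\<close>, from which it is restored.\<close>

lemma runs_copy:
  assumes "a \<noteq> b" "a \<noteq> t" "b \<noteq> t" "s t = 0"
  shows "runs ([While a [Inc b, Inc t]] @ [While t [Inc a]]) s (s(b := s b + s a))"
proof -
  let ?s = "s(b := s b + s a, t := s t + s a, a := 0)"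
  have "?s(a := ?s a + ?s t, t := 0) = s(b := s b + s a)"
    using assms by (auto simp: fun_eq_iff)
  with runs_append[OF runs_split[OF assms(1-3)] runs_move[of t a ?s]] assms(2)
  show ?thesis by metis
qed

text \<open>Registers from \<open>N\<close> on are scratch space, zero at the start. The final state
  may differ from the initial one at \<open>out\<close> only, so scratch space is returned clean and
  programs can be nested.\<close>

definition computes :: "(nat list \<Rightarrow> nat) \<Rightarrow> nat list \<Rightarrow> nat \<Rightarrow> nat \<Rightarrow> instr list \<Rightarrow> bool" where
  "computes f ins out N P \<longleftrightarrow>
     (\<forall>s. (\<forall>r\<ge>N. s r = 0) \<and> s out = 0 \<longrightarrow> runs P s (s(out := f (map s ins))))"

lemma computesD:
  "computes f ins out N P \<Longrightarrow> (\<And>r. r \<ge> N \<Longrightarrow> s r = 0) \<Longrightarrow> s out = 0 \<Longrightarrow>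
    s' = s(out := f (map s ins)) \<Longrightarrow> runs P s s'"
  unfolding computes_def by blast

text \<open>The value of the \<open>i\<close>-th function is left in register \<open>N + i\<close>.
  Induction from the right gives each further function the next register, with scratch space
  starting beyond it.\<close>

lemma computes_list:
  assumes "\<forall>g \<in> set gs. \<forall>out N. out \<notin> set ins \<longrightarrow> out < N \<longrightarrow> (\<forall>r\<in>set ins. r < N) \<longrightarrow>
      (\<exists>P. computes g ins out N P)"
    and "\<forall>r \<in> set ins. r < N"
  shows "\<exists>P. \<forall>s. (\<forall>r\<ge>N. s r = 0) \<longrightarrow>
    runs P s (\<lambda>r. if N \<le> r \<and> r < N + length gs then (gs ! (r - N)) (map s ins) else s r)"
  using assms(1)
proof (induction gs rule: rev_induct)
  case Nil
  have "(\<lambda>r. if N \<le> r \<and> r < N + length ([] :: (nat list \<Rightarrow> nat) list)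
      then ([] ! (r - N)) (map s ins) else s r) = s" for s :: "nat \<Rightarrow> nat" by auto
  then show ?case using runs_Nil by (intro exI[of _ "[]"]) simp
next
  case (snoc g gs)
  let ?t = "\<lambda>s r. if N \<le> r \<and> r < N + length gs then (gs ! (r - N)) (map s ins) else s r"
  have "\<forall>g \<in> set gs. \<forall>out N. out \<notin> set ins \<longrightarrow> out < N \<longrightarrow> (\<forall>r\<in>set ins. r < N) \<longrightarrow>
      (\<exists>P. computes g ins out N P)" using snoc.prems by simp
  from snoc.IH[OF this] obtain P where P: "\<And>s. (\<forall>r\<ge>N. s r = 0) \<Longrightarrow> runs P s (?t s)"
    by blast
  have "\<forall>r\<in>set ins. r < Suc (N + length gs)" "N + length gs \<notin> set ins"
    using assms(2) by fastforce+
  with snoc.prems obtain Q where Q: "computes g ins (N + length gs) (Suc (N + length gs)) Q"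
    by (metis in_set_conv_decomp lessI)
  show ?case
  proof (intro exI allI impI)
    fix s :: "nat \<Rightarrow> nat" assume s: "\<forall>r\<ge>N. s r = 0"
    have ins: "map (?t s) ins = map s ins" using assms(2) by auto
    have eq: "(\<lambda>r. if N \<le> r \<and> r < N + length (gs @ [g])
        then ((gs @ [g]) ! (r - N)) (map s ins) else s r) = (?t s)(N + length gs := g (map s ins))"
      by (auto simp: fun_eq_iff nth_append)
    have "runs Q (?t s) (\<lambda>r. if N \<le> r \<and> r < N + length (gs @ [g])
        then ((gs @ [g]) ! (r - N)) (map s ins) else s r)"
      unfolding eq by (rule computesD[OF Q]) (use s in \<open>simp_all only: ins, auto\<close>)
    then show "runs (P @ Q) s (\<lambda>r. if N \<le> r \<and> r < N + length (gs @ [g])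
        then ((gs @ [g]) ! (r - N)) (map s ins) else s r)"
      using runs_append[OF P[OF s]] by blast
  qed
qed

lemma computes_comp:
  assumes f: "\<And>ins out N. length ins = length gs \<Longrightarrow> out \<notin> set ins \<Longrightarrow> out < N \<Longrightarrow>
      \<forall>r\<in>set ins. r < N \<Longrightarrow> \<exists>P. computes f ins out N P"
    and g: "\<forall>g \<in> set gs. \<forall>out N. out \<notin> set ins \<longrightarrow> out < N \<longrightarrow> (\<forall>r\<in>set ins. r < N) \<longrightarrow>
      (\<exists>P. computes g ins out N P)"
    and out: "out < N" "\<forall>r\<in>set ins. r < N"
  shows "\<exists>P. computes (\<lambda>xs. f (map (\<lambda>g. g xs) gs)) ins out N P"
proof -
  let ?L = "length gs"
  let ?t = "\<lambda>s r. if N \<le> r \<and> r < N + ?L then (gs ! (r - N)) (map s ins) else s r"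
  obtain P where P: "\<And>s. (\<forall>r\<ge>N. s r = 0) \<Longrightarrow> runs P s (?t s)"
    using computes_list[OF g out(2)] by blast
  obtain Q where Q: "computes f [N..<N + ?L] out (N + ?L) Q"
    using f[of "[N..<N + ?L]" out "N + ?L"] out by auto
  obtain Z where Z: "\<And>s. runs Z s (\<lambda>r. if r \<in> set [N..<N + ?L] then 0 else s r)"
    using runs_clear_list by blast
  have "computes (\<lambda>xs. f (map (\<lambda>g. g xs) gs)) ins out N (P @ Q @ Z)"
    unfolding computes_def
  proof (intro allI impI, elim conjE)
    fix s :: "nat \<Rightarrow> nat" assume s: "\<forall>r\<ge>N. s r = 0" "s out = 0"
    let ?v = "f (map (\<lambda>g. g (map s ins)) gs)"
    have "map (?t s) [N..<N + ?L] = map (\<lambda>g. g (map s ins)) gs"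
      by (rule nth_equalityI) auto
    then have 2: "runs Q (?t s) ((?t s)(out := ?v))"
      by (intro computesD[OF Q]) (use s out in auto)
    have "(\<lambda>r. if r \<in> set [N..<N + ?L] then 0 else ((?t s)(out := ?v)) r) = s(out := ?v)"
      using s out by (auto simp: fun_eq_iff)
    then have 3: "runs Z ((?t s)(out := ?v)) (s(out := ?v))"
      using Z[of "(?t s)(out := ?v)"] by simp
    show "runs (P @ Q @ Z) s (s(out := ?v))"
      using runs_append[OF P[OF s(1)] runs_append[OF 2 3]] .
  qed
  then show ?thesis by blast
qed

lemma computes_prec:
  assumes f: "\<And>out N. out \<notin> set ins \<Longrightarrow> out < N \<Longrightarrow> \<forall>r\<in>set ins. r < N \<Longrightarrow>
      \<exists>P. computes f ins out N P"
    and g: "\<And>ins' out N. length ins' = Suc (Suc (length ins)) \<Longrightarrow> out \<notin> set ins' \<Longrightarrow> out < N \<Longrightarrow>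
      \<forall>r\<in>set ins'. r < N \<Longrightarrow> \<exists>P. computes g ins' out N P"
    and out: "out \<notin> set (a # ins)" "out < N" "\<forall>r\<in>set (a # ins). r < N"
  shows "\<exists>P. computes (\<lambda>xs. rec_nat (f (tl xs)) (\<lambda>m r. g (m # r # tl xs)) (hd xs)) (a # ins) out N P"
proof -
  \<comment> \<open>Register \<open>N\<close> counts the completed rounds, \<open>N + 1\<close> the
    rounds left; \<open>N + 2\<close> holds the current value and \<open>N + 3\<close> the next one,
    or the backup while \<open>a\<close> is copied.\<close>
  obtain P where P: "computes f ins (N + 2) (N + 4) P"
    using f[of "N + 2" "N + 4"] out by fastforce
  obtain Q where Q: "computes g (N # (N + 2) # ins) (N + 3) (N + 4) Q"
    using g[of "N # (N + 2) # ins" "N + 3" "N + 4"] out by fastforce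
  let ?B = "Q @ [While (N + 2) []] @ [While (N + 3) [Inc (N + 2)]] @ [Inc N]"
  let ?C = "[While a [Inc (N + 1), Inc (N + 3)]] @ [While (N + 3) [Inc a]]"
  have "computes (\<lambda>xs. rec_nat (f (tl xs)) (\<lambda>m r. g (m # r # tl xs)) (hd xs)) (a # ins) out N
    (P @ ?C @ [While (N + 1) ?B] @ [While (N + 2) [Inc out]] @ [While N []])"
    unfolding computes_def
  proof (intro allI impI, elim conjE)
    fix s :: "nat \<Rightarrow> nat" assume s: "\<forall>r\<ge>N. s r = 0" "s out = 0"
    let ?xs = "map s ins"
    define h where "h = rec_nat (f ?xs) (\<lambda>m r. g (m # r # ?xs))"
    define u where "u i m = s(N := i, N + 1 := m, N + 2 := h i)" for i m
    have ins: "r < N" if "r \<in> set ins" for r using out that by auto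
    have uins: "map (u i m) ins = ?xs" for i m
      using ins by (auto simp: u_def dest: ins)
    have 1: "runs P s (s(N + 2 := f ?xs))"
      by (rule computesD[OF P]) (use s in auto)
    have "u 0 (s a) = (s(N + 2 := f ?xs))(N + 1 := (s(N + 2 := f ?xs)) (N + 1) + (s(N + 2 := f ?xs)) a)"
      using s out by (auto simp: u_def h_def fun_eq_iff)
    then have 2: "runs ?C (s(N + 2 := f ?xs)) (u 0 (s a))"
      using runs_copy[of a "N + 1" "N + 3" "s(N + 2 := f ?xs)"] s out by simp
    have body: "runs ?B (u i m) (u (Suc i) m)" for i m
    proof -
      let ?w = "(u i m)(N + 3 := h (Suc i))"
      have b1: "runs Q (u i m) ?w"
      proof (rule computesD[OF Q])
        have "u i m N = i" "u i m (N + 2) = h i" by (simp_all add: u_def)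
        then have "map (u i m) (N # (N + 2) # ins) = i # h i # ?xs" using uins by (simp del: map_map)
        then show "?w = (u i m)(N + 3 := g (map (u i m) (N # (N + 2) # ins)))"
          by (simp only:) (simp add: h_def)
      qed (use s in \<open>auto simp: u_def\<close>)
      have b2: "runs [While (N + 2) []] ?w (?w(N + 2 := 0))" by (rule runs_clear)
      have "(?w(N + 2 := 0))(N + 2 := (?w(N + 2 := 0)) (N + 2) + (?w(N + 2 := 0)) (N + 3), N + 3 := 0)
          = s(N := i, N + 1 := m, N + 2 := h (Suc i))"
        using s by (auto simp: u_def fun_eq_iff)
      then have b3: "runs [While (N + 3) [Inc (N + 2)]] (?w(N + 2 := 0))
          (s(N := i, N + 1 := m, N + 2 := h (Suc i)))"
        using runs_move[of "N + 3" "N + 2" "?w(N + 2 := 0)"] by simp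
      have b4: "runs [Inc N] (s(N := i, N + 1 := m, N + 2 := h (Suc i))) (u (Suc i) m)"
        using runs_Inc[of N "s(N := i, N + 1 := m, N + 2 := h (Suc i))"]
        by (simp add: u_def fun_upd_twist)
      show ?thesis using runs_append[OF b1 runs_append[OF b2 runs_append[OF b3 b4]]] .
    qed
    have loop: "runs [While (N + 1) ?B] (u i m) (u (i + m) 0)" for i m
    proof (induction m arbitrary: i)
      case 0
      show ?case by (simp add: runs_exit u_def)
    next
      case (Suc m)
      have "(u i (Suc m))(N + 1 := m) = u i m" by (auto simp: u_def fun_eq_iff)
      then have "runs ?B ((u i (Suc m))(N + 1 := m)) (u (Suc i) m)" using body by simp
      moreover have "u i (Suc m) (N + 1) = Suc m" by (simp add: u_def)
      ultimately have "runs [While (N + 1) ?B] (u i (Suc m)) (u (Suc i + m) 0)"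
        using runs_enter Suc[of "Suc i"] by blast
      then show ?case by simp
    qed
    have 3: "runs [While (N + 1) ?B] (u 0 (s a)) (u (s a) 0)"
      using loop[of 0 "s a"] by (simp only: add_0)
    have "(u (s a) 0)(out := u (s a) 0 out + u (s a) 0 (N + 2), N + 2 := 0) = s(N := s a, out := h (s a))"
      using s out by (auto simp: u_def fun_eq_iff)
    then have 4: "runs [While (N + 2) [Inc out]] (u (s a) 0) (s(N := s a, out := h (s a)))"
      using runs_move[of "N + 2" out "u (s a) 0"] out by simp
    have "(s(N := s a, out := h (s a)))(N := 0) = s(out := h (s a))"
      using s out by (auto simp: fun_eq_iff)
    then have 5: "runs [While N []] (s(N := s a, out := h (s a))) (s(out := h (s a)))"
      using runs_clear[of N "s(N := s a, out := h (s a))"] by simp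
    have "runs (P @ ?C @ [While (N + 1) ?B] @ [While (N + 2) [Inc out]] @ [While N []]) s (s(out := h (s a)))"
      using runs_append[OF 1 runs_append[OF 2 runs_append[OF 3 runs_append[OF 4 5]]]] .
    then show "runs (P @ ?C @ [While (N + 1) ?B] @ [While (N + 2) [Inc out]] @ [While N []]) s
      (s(out := rec_nat (f (tl (map s (a # ins)))) (\<lambda>m r. g (m # r # tl (map s (a # ins))))
        (hd (map s (a # ins)))))"
      by (simp add: h_def)
  qed
  then show ?thesis by blast
qed

lemma computes_mini:
  assumes f: "\<And>ins' out N. length ins' = Suc (length ins) \<Longrightarrow> out \<notin> set ins' \<Longrightarrow> out < N \<Longrightarrow>
      \<forall>r\<in>set ins'. r < N \<Longrightarrow> \<exists>P. computes f ins' out N P"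
    and ex: "\<forall>xs. length xs = length ins \<longrightarrow> (\<exists>m. f (m # xs) = 0)"
    and out: "out < N" "\<forall>r\<in>set ins. r < N"
  shows "\<exists>P. computes (\<lambda>xs. LEAST m. f (m # xs) = 0) ins out N P"
proof -
  obtain P where P: "computes f (N # ins) (N + 1) (N + 2) P"
    using f[of "N # ins" "N + 1" "N + 2"] out by fastforce
  \<comment> \<open>Register \<open>N\<close> holds the candidate, \<open>N + 1\<close> the value of
    \<open>f\<close> there. Entering the loop takes one from \<open>N + 1\<close>; the body clears
    the rest before it tries the next candidate.\<close>
  let ?B = "[While (N + 1) []] @ [Inc N] @ P"
  have "computes (\<lambda>xs. LEAST m. f (m # xs) = 0) ins out N (P @ [While (N + 1) ?B] @ [While N [Inc out]])"
    unfolding computes_def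
  proof (intro allI impI, elim conjE)
    fix s :: "nat \<Rightarrow> nat" assume s: "\<forall>r\<ge>N. s r = 0" "s out = 0"
    let ?xs = "map s ins"
    define M where "M = (LEAST m. f (m # ?xs) = 0)"
    have "\<exists>m. f (m # ?xs) = 0" by (rule ex[rule_format]) simp
    then have M0: "f (M # ?xs) = 0" unfolding M_def by (rule LeastI_ex)
    have Mpos: "f (i # ?xs) \<noteq> 0" if "i < M" for i using that unfolding M_def by (rule not_less_Least)
    define u where "u i v = s(N := i, N + 1 := v)" for i v
    have uins: "map (u i v) ins = ?xs" for i v
      using out(2) by (intro map_cong) (auto simp: u_def)
    have s0: "s = u 0 0" using s by (auto simp: u_def fun_eq_iff)
    have run: "runs P (u i 0) (u i (f (i # ?xs)))" for i
    proof (rule computesD[OF P])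
      have "map (u i 0) (N # ins) = i # ?xs" using uins by (simp add: u_def)
      then show "u i (f (i # ?xs)) = (u i 0)(N + 1 := f (map (u i 0) (N # ins)))"
        by (simp only:) (simp add: u_def)
    qed (use s in \<open>auto simp: u_def\<close>)
    have body: "runs ?B (u i v) (u (Suc i) (f (Suc i # ?xs)))" for i v
    proof -
      have "runs [While (N + 1) []] (u i v) (u i 0)"
        using runs_clear[of "N + 1" "u i v"] by (simp add: u_def)
      moreover have "runs [Inc N] (u i 0) (u (Suc i) 0)"
        using runs_Inc[of N "u i 0"] by (simp add: u_def fun_upd_twist)
      ultimately show ?thesis using run runs_append by blast
    qed
    have loop: "runs [While (N + 1) ?B] (u i (f (i # ?xs))) (u M 0)" if "i \<le> M" for i
      using that
    proof (induction rule: inc_induct)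
      case base
      show ?case using M0 by (simp add: runs_exit u_def)
    next
      case (step i)
      then obtain v where v: "f (i # ?xs) = Suc v" using Mpos not0_implies_Suc by blast
      have "(u i (Suc v))(N + 1 := v) = u i v" by (auto simp: u_def fun_eq_iff)
      with body have "runs ?B ((u i (Suc v))(N + 1 := v)) (u (Suc i) (f (Suc i # ?xs)))" by simp
      moreover have "u i (Suc v) (N + 1) = Suc v" by (simp add: u_def)
      ultimately show ?case unfolding v using runs_enter step.IH by blast
    qed
    have "(u M 0)(out := u M 0 out + u M 0 N, N := 0) = s(out := M)"
      using s out by (auto simp: u_def fun_eq_iff)
    then have "runs [While N [Inc out]] (u M 0) (s(out := M))"
      using runs_move[of N out "u M 0"] out by simp
    then show "runs (P @ [While (N + 1) ?B] @ [While N [Inc out]]) s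
        (s(out := LEAST m. f (m # ?xs) = 0))"
      using runs_append[OF run[of 0] runs_append[OF loop[of 0]]] s0 by (simp add: M_def)
  qed
  then show ?thesis by blast
qed

theorem recursive_fun_computes:
  assumes "recursive_fun k f" "length ins = k" "out \<notin> set ins" "out < N" "\<forall>r\<in>set ins. r < N"
  shows "\<exists>P. computes f ins out N P"
  using assms
proof (induction arbitrary: ins out N rule: recursive_fun.induct)
  case (zero k)
  have "s(out := 0) = s" if "s out = 0" for s :: "nat \<Rightarrow> nat" using that by auto
  then have "computes (\<lambda>xs. 0) ins out N []" unfolding computes_def by (simp add: runs_Nil)
  then show ?case by blast
next
  case succ
  then obtain a where a: "ins = [a]" by (auto simp: length_Suc_conv)
  have "computes (\<lambda>xs. Suc (xs ! 0)) ins out N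
      (([While a [Inc out, Inc N]] @ [While N [Inc a]]) @ [Inc out])"
    unfolding computes_def
  proof (intro allI impI, elim conjE)
    fix s :: "nat \<Rightarrow> nat" assume s: "\<forall>r\<ge>N. s r = 0" "s out = 0"
    have "runs ([While a [Inc out, Inc N]] @ [While N [Inc a]]) s (s(out := s a))"
      using runs_copy[of a out N s] succ.prems s by (auto simp: a)
    from runs_append[OF this runs_Inc[of out "s(out := s a)"]]
    show "runs (([While a [Inc out, Inc N]] @ [While N [Inc a]]) @ [Inc out]) s
      (s(out := Suc (map s ins ! 0)))" by (simp add: a)
  qed
  then show ?case by blast
next
  case (proj i k)
  let ?a = "ins ! i"
  have a: "?a \<in> set ins" using proj by simp
  have "computes (\<lambda>xs. xs ! i) ins out N ([While ?a [Inc out, Inc N]] @ [While N [Inc ?a]])"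
    unfolding computes_def
  proof (intro allI impI, elim conjE)
    fix s :: "nat \<Rightarrow> nat" assume s: "\<forall>r\<ge>N. s r = 0" "s out = 0"
    have "?a \<noteq> out" "?a \<noteq> N" using a proj.prems by auto
    then have "runs ([While ?a [Inc out, Inc N]] @ [While N [Inc ?a]]) s (s(out := s ?a))"
      using runs_copy[of ?a out N s] proj.prems s by auto
    then show "runs ([While ?a [Inc out, Inc N]] @ [While N [Inc ?a]]) s (s(out := map s ins ! i))"
      using proj by simp
  qed
  then show ?case by blast
next
  case (comp gs f k)
  show ?case
    by (rule computes_comp) (use comp in \<open>auto\<close>)
next
  case (prec k f g)
  then obtain a ins' where ins: "ins = a # ins'" "length ins' = k" by (auto simp: length_Suc_conv)
  show ?case unfolding ins(1)
    by (rule computes_prec) (use prec ins in \<open>auto\<close>)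
next
  case (mini k f)
  show ?case
    by (rule computes_mini) (use mini in \<open>auto\<close>)
qed

section \<open>Counter machines\<close>

text \<open>
  A rule \<open>(q, kd, r, q')\<close> leads from state \<open>q\<close> to \<open>q'\<close> and acts on register \<open>r\<close>: \<open>kd = 7\<close>
  increments it, \<open>kd = 8\<close> decrements it if it is positive, \<open>kd = 9\<close> tests it for zero.  The numbers
  are those of the function symbols that mark the active register in the encoding below.
\<close>

definition before :: "nat \<Rightarrow> nat" where "before kd = (if kd = 8 then 1 else 0)"
definition after :: "nat \<Rightarrow> nat" where "after kd = (if kd = 7 then 1 else 0)"

text \<open>\<open>ms\<close> is common to both configurations; \<open>before\<close> and
  \<open>after\<close> add the unit at register \<open>r\<close>. In this form a step is one marked
  vector of which source and target are two readings.\<close>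

definition mstep :: "(nat \<times> nat \<times> nat \<times> nat) list \<Rightarrow> nat \<Rightarrow> nat \<times> nat list \<Rightarrow> nat \<times> nat list \<Rightarrow> bool" where
  "mstep R K v v' \<longleftrightarrow> (\<exists>q kd r q' ms. (q, kd, r, q') \<in> set R \<and> length ms = K \<and> (kd = 9 \<longrightarrow> ms ! r = 0) \<and>
     v = (q, ms[r := ms ! r + before kd]) \<and> v' = (q', ms[r := ms ! r + after kd]))"

text \<open>A finite superset of the programs that can remain while \<open>P\<close> is executed
  before \<open>k\<close>: each loop body is always followed by the same rest.\<close>

fun controls :: "instr list \<Rightarrow> instr list \<Rightarrow> instr list set" where
  "controls [] k = {k}"
| "controls (Inc r # P) k = insert (Inc r # P @ k) (controls P k)"
| "controls (While r B # P) k = controls B (While r B # P @ k) \<union> controls P k"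

lemma finite_controls: "finite (controls P k)"
  by (induction P k rule: controls.induct) auto

lemma start_in_controls: "P @ k \<in> controls P k" and end_in_controls: "k \<in> controls P k"
  by (induction P k rule: controls.induct) auto

text \<open>The exception \<open>x = k\<close> is where \<open>P\<close> has ended and a step
  belongs to the continuation; for \<open>k = []\<close> there is no such step.\<close>

lemma controls_closed:
  "x \<in> controls P k \<Longrightarrow> pstep (x, s) (y, s') \<Longrightarrow> y \<in> controls P k \<or> x = k"
proof (induction P k rule: controls.induct)
  case (2 r P k)
  then show ?case using start_in_controls[of P k] by (auto elim: pstep_IncE)
next
  case (3 r B P k)
  then show ?case
    using start_in_controls[of P k] start_in_controls[of B "While r B # P @ k"]
    by (auto elim: pstep_WhileE)
qed auto

fun rules_of :: "instr list \<Rightarrow> (nat \<times> nat \<times> nat \<times> nat) set" where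
  "rules_of [] = {}"
| "rules_of (Inc r # k) = {(to_nat (Inc r # k), 7, r, to_nat k)}"
| "rules_of (While r B # k) =
    {(to_nat (While r B # k), 8, r, to_nat (B @ While r B # k)), (to_nat (While r B # k), 9, r, to_nat k)}"

lemma map_upt_update:
  assumes "r < K"
  shows "map (s(r := v)) [0..<K] = (map s [0..<K])[r := v]"
  using assms by (intro nth_equalityI) (auto simp: nth_list_update)

lemma map_upt_update_same: "r < K \<Longrightarrow> (map s [0..<K])[r := s r] = map s [0..<K]"
  using map_upt_update[of r K s "s r"] by simp

lemma pstep_imp_mstep:
  assumes "pstep (k, s) (k', s')" "rules_of k \<subseteq> set R" "\<And>q kd r q'. (q, kd, r, q') \<in> set R \<Longrightarrow> r < K"
  shows "mstep R K (to_nat k, map s [0..<K]) (to_nat k', map s' [0..<K])"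
  using assms(1)
proof cases
  case (pstep_Inc r)
  then have r: "r < K" using assms by auto
  show ?thesis unfolding mstep_def
    by (rule exI[of _ "to_nat k"], rule exI[of _ 7], rule exI[of _ r], rule exI[of _ "to_nat k'"],
        rule exI[of _ "map s [0..<K]"])
      (use pstep_Inc assms(2) r in \<open>auto simp: before_def after_def map_upt_update map_upt_update_same\<close>)
next
  case (pstep_enter r v B k0)
  then have r: "r < K" using assms by auto
  \<comment> \<open>For a decrement the common vector is the content after the step, as
    \<open>before 8 = 1\<close> restores the old one.\<close>
  show ?thesis unfolding mstep_def
    by (rule exI[of _ "to_nat k"], rule exI[of _ 8], rule exI[of _ r], rule exI[of _ "to_nat k'"],
        rule exI[of _ "map s' [0..<K]"])
      (use pstep_enter assms(2) r map_upt_update_same[OF r, of s]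
        in \<open>auto simp: before_def after_def map_upt_update\<close>)
next
  case (pstep_exit r B)
  then have r: "r < K" using assms by auto
  show ?thesis unfolding mstep_def
    by (rule exI[of _ "to_nat k"], rule exI[of _ 9], rule exI[of _ r], rule exI[of _ "to_nat k'"],
        rule exI[of _ "map s [0..<K]"])
      (use pstep_exit assms(2) r map_upt_update_same[OF r, of s] in \<open>auto simp: before_def after_def\<close>)
qed

lemma mstep_imp_pstep:
  assumes "mstep R K (to_nat k, map s [0..<K]) v'"
    and R: "\<And>q kd r q'. (q, kd, r, q') \<in> set R \<Longrightarrow> r < K"
    and src: "\<And>x. x \<in> set R \<Longrightarrow> \<exists>k. x \<in> rules_of k"
  shows "\<exists>k' s'. v' = (to_nat k', map s' [0..<K]) \<and> pstep (k, s) (k', s')"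
proof -
  obtain kd r q' ms where rule: "(to_nat k, kd, r, q') \<in> set R" and len: "length ms = K"
    and z: "kd = 9 \<longrightarrow> ms ! r = 0" and ms: "map s [0..<K] = ms[r := ms ! r + before kd]"
    and v': "v' = (q', ms[r := ms ! r + after kd])"
    using assms(1) unfolding mstep_def by auto
  have r: "r < K" using R rule by blast
  have sr: "s r = ms ! r + before kd"
    using arg_cong[OF ms, of "\<lambda>xs. xs ! r"] r len by simp
  have upd: "ms[r := x] = map (s(r := x)) [0..<K]" for x
    using map_upt_update[OF r, of s x] ms by simp
  \<comment> \<open>Injectivity of \<open>to_nat\<close> identifies \<open>k0\<close> with
    \<open>k\<close>, so the rule reveals the first instruction of \<open>k\<close>.\<close>
  obtain k0 where "(to_nat k, kd, r, q') \<in> rules_of k0" using src rule by blast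
  then consider (inc) k1 where "k = Inc r # k1" "kd = 7" "q' = to_nat k1"
    | (dec) B k1 where "k = While r B # k1" "kd = 8" "q' = to_nat (B @ While r B # k1)"
    | (zero) B k1 where "k = While r B # k1" "kd = 9" "q' = to_nat k1"
    by (cases k0 rule: rules_of.cases) auto
  then show ?thesis
  proof cases
    case inc
    then have "pstep (k, s) (k1, s(r := Suc (ms ! r)))"
      using sr pstep_Inc[of r k1 s] by (simp add: before_def)
    moreover have "v' = (to_nat k1, map (s(r := Suc (ms ! r))) [0..<K])"
      unfolding upd[symmetric] using v' inc by (simp add: after_def)
    ultimately show ?thesis by blast
  next
    case dec
    then have "pstep (k, s) (B @ While r B # k1, s(r := ms ! r))"
      using sr by (auto intro: pstep_enter simp: before_def)
    moreover have "v' = (to_nat (B @ While r B # k1), map (s(r := ms ! r)) [0..<K])"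
      unfolding upd[symmetric] using v' dec by (simp add: after_def)
    ultimately show ?thesis by blast
  next
    case zero
    then have s0: "s r = 0" using sr z by (simp add: before_def)
    then have "pstep (k, s) (k1, s)" using zero by (auto intro: pstep_exit)
    moreover have "v' = (to_nat k1, map (s(r := 0)) [0..<K])"
      unfolding upd[symmetric] using v' zero z by (simp add: after_def)
    moreover have "s(r := 0) = s" using s0 by auto
    ultimately show ?thesis by metis
  qed
qed

theorem recursive_fun_machine:
  assumes "recursive_fun 1 f"
  obtains R K q0 qf where "0 < K" "\<And>q kd r q'. (q, kd, r, q') \<in> set R \<Longrightarrow> r < K \<and> kd \<in> {7, 8, 9}"
    "\<And>m. (mstep R K)\<^sup>*\<^sup>* (q0, m # replicate (K - 1) 0) (qf, replicate K 0) \<longleftrightarrow> f [m] = 0"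
proof -
  obtain P where P: "computes f [0] 1 2 P"
    using recursive_fun_computes[OF assms, of "[0]" 1 2] by auto
  \<comment> \<open>With the input register cleared, the final registers are all zero exactly if the
    output is zero, so acceptance means reaching one fixed configuration.\<close>
  define P0 where "P0 = P @ [While 0 []]"
  define init where "init m = (\<lambda>_ :: nat. 0 :: nat)(0 := m)" for m :: nat
  define result where "result m = (\<lambda>_ :: nat. 0 :: nat)(1 := f [m])" for m
  have run: "pstep\<^sup>*\<^sup>* (P0, init m) ([], result m)" for m
  proof -
    have "runs P (init m) ((init m)(1 := f [m]))"
      by (rule computesD[OF P]) (auto simp: init_def)
    moreover have "((init m)(1 := f [m]))(0 := 0) = result m"
      by (auto simp: init_def result_def fun_eq_iff)
    ultimately have "runs P0 (init m) (result m)"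
      unfolding P0_def using runs_append runs_clear by metis
    then show ?thesis unfolding runs_def by (metis append_Nil2)
  qed
  define RS where "RS = (\<Union>k \<in> controls P0 []. rules_of k)"
  have "finite (rules_of k)" for k by (cases k rule: rules_of.cases) auto
  then have fin: "finite RS" unfolding RS_def using finite_controls by blast
  then obtain R where R: "set R = RS" using finite_list by blast
  have "finite ((\<lambda>(q, kd, r, q'). r) ` RS)" using fin by blast
  then obtain b where b: "\<forall>r \<in> (\<lambda>(q, kd, r, q'). r) ` RS. r \<le> b"
    using finite_nat_set_iff_bounded_le by blast
  \<comment> \<open>Larger than every register in the rules, and large enough to contain the output
    register 1.\<close>
  define K where "K = b + 2"
  have rK: "r < K" if "(q, kd, r, q') \<in> set R" for q kd r q'
    using b that R unfolding K_def by fastforce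
  have kd: "kd \<in> {7, 8, 9}" if "(q, kd, r, q') \<in> set R" for q kd r q'
  proof -
    obtain k where "(q, kd, r, q') \<in> rules_of k" using \<open>(q, kd, r, q') \<in> set R\<close> R RS_def by blast
    then show ?thesis by (cases k rule: rules_of.cases) auto
  qed
  let ?e = "\<lambda>(k :: instr list, s). (to_nat k, map s [0..<K])"
  have fwd: "(mstep R K)\<^sup>*\<^sup>* (?e x) (?e y) \<and> fst y \<in> controls P0 []"
    if "pstep\<^sup>*\<^sup>* x y" "fst x \<in> controls P0 []" for x y
    using that
  proof (induction rule: rtranclp_induct)
    case (step y z)
    obtain k s k' s' where yz: "y = (k, s)" "z = (k', s')" by (cases y, cases z)
    from step have k: "k \<in> controls P0 []" "pstep (k, s) (k', s')" by (auto simp: yz)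
    then have "rules_of k \<subseteq> set R" unfolding R RS_def by blast
    then have "mstep R K (?e y) (?e z)" using pstep_imp_mstep[OF k(2)] rK by (simp add: yz)
    moreover have "k' \<in> controls P0 []"
      using controls_closed[OF k] k(2) by (auto elim: pstep_NilE)
    ultimately show ?case using step by (auto simp: yz)
  qed auto
  have bwd: "\<exists>y. w = ?e y \<and> pstep\<^sup>*\<^sup>* x y" if "(mstep R K)\<^sup>*\<^sup>* (?e x) w" for x w
    using that
  proof (induction rule: rtranclp_induct)
    case base
    show ?case by blast
  next
    case (step v w)
    then obtain k s where y: "v = ?e (k, s)" "pstep\<^sup>*\<^sup>* x (k, s)" by auto
    with step have "mstep R K (to_nat k, map s [0..<K]) w" by simp
    moreover have "\<exists>k. x \<in> rules_of k" if "x \<in> set R" for x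
      using that unfolding R RS_def by blast
    ultimately obtain k' s' where "w = ?e (k', s')" "pstep (k, s) (k', s')"
      using mstep_imp_pstep[of R K k s w] rK by auto
    then show ?case using y(2) by (intro exI[of _ "(k', s')"]) auto
  qed
  have einit: "?e (P0, init m) = (to_nat P0, m # replicate (K - 1) 0)" for m
    by (auto simp: init_def K_def list_eq_iff_nth_eq nth_Cons' simp del: upt_Suc)
  have iff: "(mstep R K)\<^sup>*\<^sup>* (to_nat P0, m # replicate (K - 1) 0) (to_nat ([] :: instr list), replicate K 0)
    \<longleftrightarrow> f [m] = 0" (is "?L \<longleftrightarrow> ?R") for m
  proof
    assume ?L
    then obtain k s where y: "(to_nat ([] :: instr list), replicate K 0) = ?e (k, s)"
      "pstep\<^sup>*\<^sup>* (P0, init m) (k, s)"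
      using bwd[of "(P0, init m)"] unfolding einit by force
    then have "k = []" by simp
    \<comment> \<open>By determinism the halting run just found ends like the run of the compiled
      program.\<close>
    with y(2) run have "s = result m" using pstep_result_unique by blast
    moreover have "map s [0..<K] ! 1 = replicate K 0 ! 1" using y(1) by simp
    ultimately show ?R by (simp add: K_def result_def del: upt_Suc)
  next
    assume ?R
    then have "result m = (\<lambda>_. 0)" by (auto simp: result_def)
    then have "?e ([], result m) = (to_nat ([] :: instr list), replicate K 0)"
      by (simp add: map_replicate_const)
    with fwd[OF run] start_in_controls[of P0 "[]"] show ?L
      unfolding einit[symmetric] by (metis append_Nil2 fst_conv)
  qed
  show ?thesis
    by (rule that[OF _ _ iff]) (use rK kd in \<open>auto simp: K_def\<close>)
qed

section \<open>Skeletons and simultaneous instances\<close>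

lemma val_subst_tm: "val M e (subst_tm \<tau> t) = val M (\<lambda>x. val M e (\<tau> x)) t"
  by (induction t) (auto cong: map_cong simp: comp_def)

lemma sat_subst: "qfree A \<Longrightarrow> sat M e (subst \<tau> A) = sat M (\<lambda>x. val M e (\<tau> x)) A"
  by (induction A) (auto simp: val_subst_tm comp_def)

lemma replace_subst_tm:
  "unknowns_tm U t = {} \<Longrightarrow> replace_tm U \<sigma> (subst_tm \<theta> t) = subst_tm (\<lambda>x. replace_tm U \<sigma> (\<theta> x)) t"
proof (induction t)
  case (Fun i ts)
  then have "\<not> (ts = [] \<and> i \<in> U)" "\<forall>t\<in>set ts. unknowns_tm U t = {}" by (auto split: if_splits)
  with Fun.IH show ?case by (auto simp: comp_def)
qed auto

lemma replace_subst:
  "qfree A \<Longrightarrow> unknowns U A = {} \<Longrightarrow>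
    replace U \<sigma> (subst \<theta> A) = subst (\<lambda>x. replace_tm U \<sigma> (\<theta> x)) A"
  by (induction A) (auto simp: replace_subst_tm)

lemma qfree_subst: "qfree (subst \<theta> A) = qfree A"
  by (induction A arbitrary: \<theta>) auto

lemma disjunction_properties:
  assumes "As \<noteq> []"
  shows sat_disjunction: "sat M e (disjunction As) \<longleftrightarrow> (\<exists>A\<in>set As. sat M e A)"
    and replace_disjunction: "replace U \<sigma> (disjunction As) = disjunction (map (replace U \<sigma>) As)"
    and qfree_disjunction: "qfree (disjunction As) \<longleftrightarrow> (\<forall>A\<in>set As. qfree A)"
  using assms by (induction As rule: disjunction.induct) auto

text \<open>\<open>Sk\<close> asks for some prefix and some matrix; the formula determines
  both.\<close>

lemma foldr_Exi_inject:
  "foldr Exi xs A = foldr Exi ys B \<Longrightarrow> qfree A \<Longrightarrow> qfree B \<Longrightarrow> xs = ys \<and> A = B"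
proof (induction xs arbitrary: ys)
  case Nil
  then show ?case by (cases ys) auto
next
  case (Cons x xs)
  show ?case
  proof (cases ys)
    case Nil
    then have "B = Exi x (foldr Exi xs A)" using Cons.prems(1) by simp
    with Cons.prems(3) show ?thesis by simp
  next
    case (Cons y ys')
    with Cons.prems have "x = y" "foldr Exi xs A = foldr Exi ys' B" by auto
    with Cons.IH[of ys'] Cons.prems Cons show ?thesis by blast
  qed
qed

lemma free_vars_foldr_Exi: "free_vars (foldr Exi xs A) = free_vars A - set xs"
  by (induction xs) auto

lemma subst_tm_cong: "(\<And>x. x \<in> vars_tm t \<Longrightarrow> \<theta> x = \<theta>' x) \<Longrightarrow> subst_tm \<theta> t = subst_tm \<theta>' t"
  by (induction t) auto

lemma subst_cong_qfree:
  "qfree A \<Longrightarrow> (\<And>x. x \<in> free_vars A \<Longrightarrow> \<theta> x = \<theta>' x) \<Longrightarrow> subst \<theta> A = subst \<theta>' A"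
  by (induction A) (auto intro!: subst_tm_cong)

text \<open>\<open>valid_adequate\<close> carries validity over \<open>'a\<close> to structures over
  any type \<open>'b\<close>, which gives access to products. Which of the \<open>n\<close>
  instances is true may depend on the structure.\<close>

lemma Sk_imp_instances:
  assumes Sk: "Sk TYPE('a) U n (foldr Exi xs A)" and inf: "infinite (UNIV :: 'a set)"
    and qf: "qfree A" and n: "n \<ge> 1"
  obtains \<tau> :: "nat \<Rightarrow> nat \<Rightarrow> tm"
  where "\<And>(M :: 'b fo_structure) e. is_structure M \<Longrightarrow> range e \<subseteq> Dom M \<Longrightarrow>
    \<exists>i<n. sat M (\<lambda>x. val M e (\<tau> i x)) A"
proof -
  obtain ys B S where ex: "existential U ys B (foldr Exi xs A)" and sk: "skeleton U n ys B S"
    and solv: "solvable TYPE('a) U S" using Sk unfolding Sk_def by blast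
  then have eq: "foldr Exi xs A = foldr Exi ys B" "qfree B" and unk: "unknowns U B = {}"
    by (auto simp: existential_def)
  have [simp]: "ys = xs" "B = A" using foldr_Exi_inject[OF eq(1) qf eq(2)] by auto
  obtain uss where uss: "length uss = n" "S = disjunction (map (\<lambda>us. instantiate xs us A) uss)"
    using sk unfolding skeleton_def by auto
  obtain \<sigma> where \<sigma>: "valid TYPE('a) (replace U \<sigma> S)"
    using solv unfolding solvable_def solution_def by blast
  have ne: "uss \<noteq> []" using uss n by auto
  define \<theta> where "\<theta> us x = (case map_of (zip xs us) x of Some u \<Rightarrow> Const u | None \<Rightarrow> Var x)" for us x
  define \<tau> where "\<tau> i x = replace_tm U \<sigma> (\<theta> (uss ! i) x)" for i x
  have inst: "replace U \<sigma> (instantiate xs us A) = subst (\<lambda>x. replace_tm U \<sigma> (\<theta> us x)) A" for us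
    using replace_subst[OF qf, of U \<sigma> "\<theta> us"] unk unfolding instantiate_def \<theta>_def by simp
  have S: "replace U \<sigma> S = disjunction (map (\<lambda>us. subst (\<lambda>x. replace_tm U \<sigma> (\<theta> us x)) A) uss)"
    unfolding uss(2) using ne by (simp add: replace_disjunction inst comp_def)
  have "\<exists>i<n. sat M (\<lambda>x. val M e (\<tau> i x)) A"
    if M: "is_structure M" "range e \<subseteq> Dom M" for M :: "'b fo_structure" and e
  proof -
    have "qfree (replace U \<sigma> S)"
      unfolding S using ne qf by (auto simp: qfree_disjunction qfree_subst)
    from valid_adequate[OF inf \<sigma> this M] obtain us where "us \<in> set uss"
      "sat M e (subst (\<lambda>x. replace_tm U \<sigma> (\<theta> us x)) A)"
      unfolding S using ne by (auto simp: sat_disjunction)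
    then show ?thesis using uss(1) qf by (auto simp: in_set_conv_nth sat_subst \<tau>_def)
  qed
  then show ?thesis using that by blast
qed

text \<open>One valid instance suffices: all blocks of unknowns are sent to the same terms.\<close>

lemma instance_imp_Sk:
  assumes "infinite U" and qf: "qfree A" and unk: "unknowns U A = {}" and n: "n \<ge> 1"
    and xs: "distinct xs" "free_vars A \<subseteq> set xs"
    and \<tau>: "\<And>x. vars_tm (\<tau> x) = {}" "\<And>x. unknowns_tm U (\<tau> x) = {}"
    and valid: "\<And>(M :: 'a fo_structure) e. is_structure M \<Longrightarrow> range e \<subseteq> Dom M \<Longrightarrow>
      sat M (\<lambda>x. val M e (\<tau> x)) A"
  shows "Sk TYPE('a) U n (foldr Exi xs A)"
proof -
  obtain g :: "nat \<Rightarrow> nat" where g: "inj g" "range g \<subseteq> U"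
    using infinite_countable_subset[OF assms(1)] by blast
  define us where "us i = map (\<lambda>j. g (prod_encode (i, j))) [0..<length xs]" for i
  define uss where "uss = map us [0..<n]"
  define S where "S = disjunction (map (\<lambda>us. instantiate xs us A) uss)"
  \<comment> \<open>The position inside the block is decoded from the unknown, and the block number
    is dropped.\<close>
  define \<sigma> where "\<sigma> u = \<tau> (xs ! snd (prod_decode (inv g u)))" for u
  have ne: "uss \<noteq> []" using n by (simp add: uss_def)
  have inj: "g (prod_encode (i, j)) = g (prod_encode (i', j')) \<longleftrightarrow> i = i' \<and> j = j'" for i j i' j'
    using inj_eq[OF g(1)] by simp
  have "distinct (concat (map us [0..<k]))" for k
    by (induction k) (auto simp: us_def distinct_map inj_on_def inj)
  then have "skeleton U n xs A S"
    unfolding skeleton_def S_def using g(2)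
    by (intro exI[of _ uss]) (auto simp: uss_def us_def)
  moreover have "existential U xs A (foldr Exi xs A)"
    unfolding existential_def using xs qf unk by (auto simp: free_vars_foldr_Exi)
  moreover have "solvable TYPE('a) U S"
    unfolding solvable_def
  proof (intro conjI exI)
    show "qfree S" unfolding S_def using ne qf
      by (auto simp: qfree_disjunction instantiate_def qfree_subst)
    have "sat M e (replace U \<sigma> S)" if M: "is_structure M" "range e \<subseteq> Dom M"
      for M :: "'a fo_structure" and e
    proof -
      let ?\<theta> = "\<lambda>x. case map_of (zip xs (us 0)) x of Some u \<Rightarrow> Const u | None \<Rightarrow> Var x"
      have "replace_tm U \<sigma> (?\<theta> x) = \<tau> x" if x: "x \<in> set xs" for x
      proof -
        obtain j where j: "j < length xs" "x = xs ! j" using x by (auto simp: in_set_conv_nth)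
        then have "map_of (zip xs (us 0)) x = Some (us 0 ! j)"
          using map_of_zip_nth[of xs "us 0" j] xs(1) by (simp add: us_def)
        then show ?thesis using j g by (auto simp: us_def \<sigma>_def)
      qed
      then have "subst (\<lambda>x. replace_tm U \<sigma> (?\<theta> x)) A = subst \<tau> A"
        using xs(2) qf subst_cong_qfree by (metis (no_types, lifting) subsetD)
      then have "replace U \<sigma> (instantiate xs (us 0) A) = subst \<tau> A"
        unfolding instantiate_def using replace_subst[OF qf unk] by simp
      moreover have "us 0 \<in> set uss" using n by (auto simp: uss_def)
      moreover have "sat M e (subst \<tau> A)" using valid[OF M] qf by (simp add: sat_subst)
      ultimately show ?thesis
        unfolding S_def using ne by (auto simp: replace_disjunction sat_disjunction intro!: bexI[of _ "us 0"])
    qed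
    then show "solution TYPE('a) U S \<sigma>"
      unfolding solution_def valid_def using \<tau> by (auto simp: \<sigma>_def)
  qed
  ultimately show ?thesis unfolding Sk_def by blast
qed

section \<open>Horn constraints\<close>

text \<open>The language has no truth constant, so \<open>c = c\<close> stands for the empty
  conjunction; \<open>c\<close> will be a constant outside the unknowns.\<close>

primrec conjs :: "nat \<Rightarrow> fm list \<Rightarrow> fm" where
  "conjs c [] = Eql (Const c) (Const c)"
| "conjs c (A # As) = Conj A (conjs c As)"

lemma sat_conjs: "sat M e (conjs c As) \<longleftrightarrow> (\<forall>A\<in>set As. sat M e A)"
  by (induction As) auto

lemma qfree_conjs: "qfree (conjs c As) \<longleftrightarrow> (\<forall>A\<in>set As. qfree A)"
  by (induction As) auto

lemma free_vars_conjs: "free_vars (conjs c As) = (\<Union>A\<in>set As. free_vars A)"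
  by (induction As) auto

lemma unknowns_conjs: "c \<notin> U \<Longrightarrow> unknowns U (conjs c As) = (\<Union>A\<in>set As. unknowns U A)"
  by (induction As) auto

definition eqs :: "'a fo_structure \<Rightarrow> (nat \<Rightarrow> 'a) \<Rightarrow> (tm \<times> tm) list \<Rightarrow> bool" where
  "eqs M e E \<longleftrightarrow> (\<forall>(s, t) \<in> set E. val M e s = val M e t)"

lemma eqsD: "eqs M e E \<Longrightarrow> (s, t) \<in> set E \<Longrightarrow> val M e s = val M e t"
  by (auto simp: eqs_def)

text \<open>For ground \<open>E\<close>, validity of an instance means that \<open>E\<close> entails
  the instantiated equation: a rigid E-unification problem.\<close>

definition horn :: "nat \<Rightarrow> (tm \<times> tm) list \<Rightarrow> tm \<Rightarrow> tm \<Rightarrow> fm" where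
  "horn c E s t = Impl (conjs c (map (\<lambda>(s, t). Eql s t) E)) (Eql s t)"

lemma sat_horn: "sat M e (horn c E s t) \<longleftrightarrow> (eqs M e E \<longrightarrow> val M e s = val M e t)"
  by (auto simp: horn_def sat_conjs eqs_def)

lemma qfree_horn: "qfree (horn c E s t)"
  by (auto simp: horn_def qfree_conjs)

lemma free_vars_horn:
  "free_vars (horn c E s t) = (\<Union>(a, b)\<in>set E. vars_tm a \<union> vars_tm b) \<union> vars_tm s \<union> vars_tm t"
  by (auto simp: horn_def free_vars_conjs)

lemma unknowns_horn:
  "c \<notin> U \<Longrightarrow> unknowns U (horn c E s t) =
    (\<Union>(a, b)\<in>set E. unknowns_tm U a \<union> unknowns_tm U b) \<union> unknowns_tm U s \<union> unknowns_tm U t"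
  by (auto simp: horn_def unknowns_conjs)

section \<open>Encoding the runs of a counter machine\<close>

definition tsuc :: "nat \<Rightarrow> tm \<Rightarrow> tm" where "tsuc l a = Fun (prod_encode (l, 2)) [a]"
text \<open>With \<open>Const c\<close> at the bottom this is a numeral; with a register mark there
  it is a numeral whose zero is still open.\<close>

definition shift :: "nat \<Rightarrow> nat \<Rightarrow> tm \<Rightarrow> tm" where "shift l j t = (tsuc l ^^ j) t"

text \<open>Kept apart from the matrix and independent of the machine: the diagonal function has to
  write the input, whereas the matrix must be the same for all inputs.\<close>

definition inputs :: "nat \<Rightarrow> nat \<Rightarrow> nat \<Rightarrow> fm" where
  "inputs c n m = conjs c (map (\<lambda>l. Eql (Var (3 * l)) (shift l m (Const c))) [0..<n])"

locale machine =
  fixes c K q0 qf :: nat and R :: "(nat \<times> nat \<times> nat \<times> nat) list"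
  assumes K_pos: "0 < K"
    and rules: "(q, kd, r, q') \<in> set R \<Longrightarrow> r < K \<and> kd \<in> {7, 8, 9}"
begin

text \<open>
  The symbols of copy \<open>l\<close> are the function symbols of positive arity with index \<open>prod_encode (l, k)\<close>:
  \<open>k = 0\<close> forms configurations, 1 is the list constructor and 2 the successor.  The remaining ones
  are applied to the constant \<open>c\<close>, which is the number zero, and act as further constants:
  3 is the end of a list of steps, 4 the end of a list of configurations, 7, 8 and 9 the active
  register of a step, \<open>10 + 2q\<close> the state \<open>q\<close>, and \<open>11 + 2 prod_encode (q, q')\<close> a change of state.
\<close>

definition atom :: "nat \<Rightarrow> nat \<Rightarrow> tm" where "atom l k = Fun (prod_encode (l, k)) [Const c]"
definition tcfg :: "nat \<Rightarrow> tm list \<Rightarrow> tm" where "tcfg l ts = Fun (prod_encode (l, 0)) ts"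
definition tcons :: "nat \<Rightarrow> tm \<Rightarrow> tm \<Rightarrow> tm" where "tcons l a b = Fun (prod_encode (l, 1)) [a, b]"
abbreviation num :: "nat \<Rightarrow> nat \<Rightarrow> tm" where "num l m \<equiv> shift l m (Const c)"

abbreviation state :: "nat \<Rightarrow> nat" where "state q \<equiv> 10 + 2 * q"
abbreviation change :: "nat \<Rightarrow> nat \<Rightarrow> nat" where "change q q' \<equiv> 11 + 2 * prod_encode (q, q')"

definition final :: "nat \<Rightarrow> tm" where "final l = tcfg l (atom l (state qf) # replicate K (Const c))"

text \<open>Read from left to right, these are the transitions of the tree automaton: a list of
  steps collapses to atom 3, a list of configurations to atom 4. The marks 7 and 8 absorb successors
  and 9 does not, so a register tested for zero must carry the bare mark.\<close>

definition sort_eqs :: "nat \<Rightarrow> (tm \<times> tm) list" where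
  "sort_eqs l =
    [(tsuc l (Const c), Const c), (tsuc l (atom l 7), atom l 7), (tsuc l (atom l 8), atom l 8)] @
    map (\<lambda>(q, kd, r, q'). (tcons l (tcfg l (atom l (change q q') # (replicate K (Const c))[r := atom l kd]))
      (atom l 3), atom l 3)) R @
    map (\<lambda>q. (tcons l (tcfg l (atom l (state q) # replicate K (Const c))) (atom l 4), atom l 4))
      (qf # map fst R)"

text \<open>The end mark 3 unfolds to the final configuration, because the sources of the steps are
  all configurations but the last.\<close>

definition source_eqs :: "nat \<Rightarrow> (tm \<times> tm) list" where
  "source_eqs l = map (\<lambda>(q, kd, r, q'). (atom l (change q q'), atom l (state q))) R @
    [(atom l 7, Const c), (atom l 8, tsuc l (Const c)), (atom l 9, Const c),
     (atom l 3, tcons l (final l) (atom l 4))]"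

text \<open>Here 3 is the empty list: the targets are all configurations but the first, which
  \<open>constraints\<close> puts in front.\<close>

definition target_eqs :: "nat \<Rightarrow> (tm \<times> tm) list" where
  "target_eqs l = map (\<lambda>(q, kd, r, q'). (atom l (change q q'), atom l (state q'))) R @
    [(atom l 7, tsuc l (Const c)), (atom l 8, Const c), (atom l 9, Const c), (atom l 3, atom l 4)]"

text \<open>
  In copy \<open>l\<close>, the variables \<open>3l\<close>, \<open>3l + 1\<close> and \<open>3l + 2\<close> stand for the input, the list of steps and the
  list of configurations of an accepting run.
\<close>

definition constraints :: "nat \<Rightarrow> ((tm \<times> tm) list \<times> tm \<times> tm) list" where
  "constraints l =
    [(sort_eqs l, Var (3 * l + 1), atom l 3),
     (source_eqs l, Var (3 * l + 1), Var (3 * l + 2)),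
     (target_eqs l, tcons l (tcfg l (atom l (state q0) # Var (3 * l) # replicate (K - 1) (Const c)))
        (Var (3 * l + 1)), Var (3 * l + 2)),
     (sort_eqs l, Var (3 * l + 2), atom l 4)]"

definition matrix :: "nat \<Rightarrow> fm" where
  "matrix n = conjs c (map (\<lambda>l. conjs c (map (\<lambda>(E, s, t). horn c E s t) (constraints l))) [0..<n])"

abbreviation accepts :: "nat \<Rightarrow> bool" where
  "accepts m \<equiv> (mstep R K)\<^sup>*\<^sup>* (q0, m # replicate (K - 1) 0) (qf, replicate K 0)"

subsection \<open>Accepting runs solve the constraints\<close>

definition tconf :: "nat \<Rightarrow> nat \<times> nat list \<Rightarrow> tm" where
  "tconf l v = tcfg l (atom l (state (fst v)) # map (num l) (snd v))"

text \<open>The set of unknowns is not fixed here; the quantifier over \<open>U\<close> leaves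
  \<open>c\<close> as the only constant that may occur.\<close>

definition admissible :: "tm \<Rightarrow> bool" where
  "admissible t \<longleftrightarrow> vars_tm t = {} \<and> (\<forall>U. c \<notin> U \<longrightarrow> unknowns_tm U t = {})"

lemma admissible_Fun: "ts \<noteq> [] \<Longrightarrow> (\<And>t. t \<in> set ts \<Longrightarrow> admissible t) \<Longrightarrow> admissible (Fun i ts)"
  by (auto simp: admissible_def)

lemma admissible_const: "admissible (Const c)"
  by (auto simp: admissible_def)

lemma admissible_atom: "admissible (atom l k)"
  unfolding atom_def by (rule admissible_Fun) (auto simp: admissible_const)

lemma admissible_tcons: "admissible a \<Longrightarrow> admissible b \<Longrightarrow> admissible (tcons l a b)"
  unfolding tcons_def by (rule admissible_Fun) auto

lemma admissible_shift: "admissible t \<Longrightarrow> admissible (shift l j t)"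
  unfolding shift_def by (induction j) (auto simp: tsuc_def intro: admissible_Fun)

lemma admissible_tcfg: "admissible a \<Longrightarrow> (\<And>t. t \<in> set ts \<Longrightarrow> admissible t) \<Longrightarrow> admissible (tcfg l (a # ts))"
  unfolding tcfg_def by (rule admissible_Fun) auto

lemma admissible_tconf: "admissible (tconf l v)"
  unfolding tconf_def by (rule admissible_tcfg) (auto intro: admissible_atom admissible_shift admissible_const)

lemma val_tcfg: "val M e (tcfg l ts) = FunI M (prod_encode (l, 0)) (map (val M e) ts)"
  by (simp add: tcfg_def)

lemma val_tcons: "val M e (tcons l a b) = FunI M (prod_encode (l, 1)) [val M e a, val M e b]"
  by (simp add: tcons_def)

lemma val_shift_cong: "val M e s = val M e t \<Longrightarrow> val M e (shift l j s) = val M e (shift l j t)"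
  unfolding shift_def by (induction j) (auto simp: tsuc_def)

lemma val_shift_fixed: "val M e (tsuc l t) = val M e t \<Longrightarrow> val M e (shift l j t) = val M e t"
  unfolding shift_def by (induction j) (auto simp: tsuc_def)

lemma shift_Suc: "shift l (Suc j) t = shift l j (tsuc l t)"
  unfolding shift_def by (simp add: funpow_swap1)

text \<open>Induction along the run from its end: each step adds a marked configuration to
  \<open>W\<close> and its source configuration to \<open>Y\<close>.\<close>

lemma run_solves:
  assumes "(mstep R K)\<^sup>*\<^sup>* v (qf, replicate K 0)"
  shows "\<exists>W Y. admissible W \<and> admissible Y \<and> (\<forall>(M :: 'a fo_structure) e.
    (eqs M e (sort_eqs l) \<longrightarrow> val M e W = val M e (atom l 3)) \<and>
    (eqs M e (source_eqs l) \<longrightarrow> val M e W = val M e Y) \<and>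
    (eqs M e (target_eqs l) \<longrightarrow> val M e (tcons l (tconf l v) W) = val M e Y) \<and>
    (eqs M e (sort_eqs l) \<longrightarrow> val M e Y = val M e (atom l 4)))"
  using assms
proof (induction rule: converse_rtranclp_induct)
  case base
  have fin: "tconf l (qf, replicate K 0) = final l" by (simp add: tconf_def final_def shift_def)
  show ?case
    by (intro exI[of _ "atom l 3"] exI[of _ "tcons l (final l) (atom l 4)"])
      (auto simp: fin eqs_def sort_eqs_def source_eqs_def target_eqs_def val_tcons final_def[symmetric]
        simp flip: fin intro: admissible_atom admissible_tcons admissible_tconf)
next
  case (step v v')
  then obtain W Y where adm: "admissible W" "admissible Y"
    and IH: "\<And>(M :: 'a fo_structure) e. eqs M e (sort_eqs l) \<Longrightarrow> val M e W = val M e (atom l 3)"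
      "\<And>(M :: 'a fo_structure) e. eqs M e (source_eqs l) \<Longrightarrow> val M e W = val M e Y"
      "\<And>(M :: 'a fo_structure) e. eqs M e (target_eqs l) \<Longrightarrow> val M e (tcons l (tconf l v') W) = val M e Y"
      "\<And>(M :: 'a fo_structure) e. eqs M e (sort_eqs l) \<Longrightarrow> val M e Y = val M e (atom l 4)"
    by blast
  obtain q kd r q' ms where rule: "(q, kd, r, q') \<in> set R" and len: "length ms = K"
    and z: "kd = 9 \<longrightarrow> ms ! r = 0" and v: "v = (q, ms[r := ms ! r + before kd])"
    and v': "v' = (q', ms[r := ms ! r + after kd])"
    using step.hyps(1) unfolding mstep_def by blast
  have r: "r < K" and kd: "kd = 7 \<or> kd = 8 \<or> kd = 9" using rules[OF rule] by auto
  \<comment> \<open>The mark replaces the zero of the active register's numeral. Reading it as 0 or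
    1 adds \<open>before kd\<close> or \<open>after kd\<close> to \<open>ms ! r\<close>.\<close>
  define P where "P = tcfg l (atom l (change q q') #
    (map (num l) ms)[r := shift l (ms ! r) (atom l kd)])"
  have admP: "admissible P" unfolding P_def
    by (rule admissible_tcfg)
      (auto intro!: admissible_atom admissible_shift admissible_const dest!: set_update_subset_insert[THEN subsetD])
  have regs: "map (val M e) ((map (num l) ms)[r := shift l (ms ! r) (atom l kd)])
      = map (val M e) (map (num l) (ms[r := ms ! r + b]))"
    if "val M e (shift l (ms ! r) (atom l kd)) = val M e (shift l (ms ! r + b) (Const c))"
    for M :: "'a fo_structure" and e b
    using that by (simp add: map_update)
  have sort: "val M e (tcons l P t) = val M e (atom l 3)"
    if E: "eqs M e (sort_eqs l)" and t: "val M e t = val M e (atom l 3)" for M :: "'a fo_structure" and e t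
  proof -
    have c0: "val M e (num l j) = val M e (Const c)" for j
      by (rule val_shift_fixed) (use E in \<open>auto simp: eqs_def sort_eqs_def\<close>)
    \<comment> \<open>The mark 9 has no equation that absorbs successors, but then
      \<open>ms ! r = 0\<close> and there are none.\<close>
    have "val M e (shift l (ms ! r) (atom l kd)) = val M e (atom l kd)"
    proof (cases "kd = 9")
      case True
      then show ?thesis using z by (simp add: shift_def)
    next
      case False
      with kd show ?thesis by (intro val_shift_fixed) (use E in \<open>auto simp: eqs_def sort_eqs_def\<close>)
    qed
    then have "map (val M e) ((map (num l) ms)[r := shift l (ms ! r) (atom l kd)])
        = map (val M e) ((replicate K (Const c))[r := atom l kd])"
      using c0 len by (simp add: map_update map_replicate_const comp_def)
    then have "val M e (tcons l P t) = val M e (tcons l (tcfg l (atom l (change q q') #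
        (replicate K (Const c))[r := atom l kd])) (atom l 3))"
      using t by (simp add: P_def val_tcons val_tcfg)
    also have "\<dots> = val M e (atom l 3)"
      by (rule eqsD[OF E]) (use rule in \<open>force simp: sort_eqs_def\<close>)
    finally show ?thesis .
  qed
  have src: "val M e P = val M e (tconf l v)" if E: "eqs M e (source_eqs l)" for M :: "'a fo_structure" and e
  proof -
    have "val M e (atom l (change q q')) = val M e (atom l (state q))"
      by (rule eqsD[OF E]) (use rule in \<open>force simp: source_eqs_def\<close>)
    moreover have "val M e (shift l (ms ! r) (atom l kd)) = val M e (shift l (ms ! r + before kd) (Const c))"
      using kd E by (auto simp: before_def eqs_def source_eqs_def shift_Suc intro!: val_shift_cong)
    ultimately show ?thesis using regs[of M e "before kd"] by (simp add: P_def tconf_def v val_tcfg)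
  qed
  have tgt: "val M e P = val M e (tconf l v')" if E: "eqs M e (target_eqs l)" for M :: "'a fo_structure" and e
  proof -
    have "val M e (atom l (change q q')) = val M e (atom l (state q'))"
      by (rule eqsD[OF E]) (use rule in \<open>force simp: target_eqs_def\<close>)
    moreover have "val M e (shift l (ms ! r) (atom l kd)) = val M e (shift l (ms ! r + after kd) (Const c))"
      using kd E by (auto simp: after_def eqs_def target_eqs_def shift_Suc intro!: val_shift_cong)
    ultimately show ?thesis using regs[of M e "after kd"] by (simp add: P_def tconf_def v' val_tcfg)
  qed
  have plain: "val M e (tcons l (tconf l v) t) = val M e (atom l 4)"
    if E: "eqs M e (sort_eqs l)" and t: "val M e t = val M e (atom l 4)" for M :: "'a fo_structure" and e t
  proof -
    have c0: "val M e (num l j) = val M e (Const c)" for j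
      by (rule val_shift_fixed) (use E in \<open>auto simp: eqs_def sort_eqs_def\<close>)
    have "map (val M e) (map (num l) (snd v)) = map (val M e) (replicate K (Const c))"
      using len c0 by (simp add: v map_replicate_const comp_def)
    then have "val M e (tcons l (tconf l v) t) =
        val M e (tcons l (tcfg l (atom l (state q) # replicate K (Const c))) (atom l 4))"
      using t by (simp add: v tconf_def val_tcons val_tcfg)
    also have "\<dots> = val M e (atom l 4)"
      by (rule eqsD[OF E]) (use rule in \<open>force simp: sort_eqs_def\<close>)
    finally show ?thesis .
  qed
  show ?case
    by (intro exI[of _ "tcons l P W"] exI[of _ "tcons l (tconf l v) Y"])
      (use adm admP IH sort src tgt plain in \<open>auto simp: val_tcons intro: admissible_tcons admissible_tconf\<close>)
qed

end

subsection \<open>Countermodels\<close>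

text \<open>
  All symbols that do not belong to copy \<open>l\<close> are interpreted by the value of the constants; hence
  the equations of the other copies hold trivially.
\<close>

definition copy_structure :: "nat \<Rightarrow> 'a \<Rightarrow> (nat \<Rightarrow> 'a list \<Rightarrow> 'a) \<Rightarrow> 'a fo_structure" where
  "copy_structure l d F = \<lparr>Dom = UNIV,
     FunI = (\<lambda>i as. if as = [] \<or> fst (prod_decode i) \<noteq> l then d else F (snd (prod_decode i)) as),
     PredI = (\<lambda>_ _. True)\<rparr>"

text \<open>An equation holds in the product iff it holds in every component. So a Horn constraint
  fails there if its hypotheses hold in all components and its conclusion fails in one.\<close>

definition product_structure :: "(nat \<Rightarrow> 'a fo_structure) \<Rightarrow> (nat \<Rightarrow> 'a) fo_structure" where
  "product_structure N = \<lparr>Dom = UNIV, FunI = (\<lambda>i as l. FunI (N l) i (map (\<lambda>a. a l) as)),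
     PredI = (\<lambda>_ _. True)\<rparr>"

lemma val_product: "val (product_structure N) e t l = val (N l) (\<lambda>x. e x l) t"
  by (induction t) (auto simp: product_structure_def comp_def cong: map_cong)

lemma val_copy_Fun:
  "val (copy_structure l d F) e (Fun i ts) =
    (if ts = [] \<or> fst (prod_decode i) \<noteq> l then d
     else F (snd (prod_decode i)) (map (val (copy_structure l d F) e) ts))"
  by (simp add: copy_structure_def)

lemma FunI_copy:
  "FunI (copy_structure l d F) i as =
    (if as = [] \<or> fst (prod_decode i) \<noteq> l then d else F (snd (prod_decode i)) as)"
  by (simp add: copy_structure_def)

text \<open>A value carries all the attributes that a term might have: a number, a state, a configuration
  and a list of configurations.\<close>

datatype cell = Cell (cnum: nat) (cstate: nat) (cconf: "nat \<times> nat list") (clist: "(nat \<times> nat list) list")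

abbreviation cell_num :: "nat \<Rightarrow> cell" where "cell_num k \<equiv> Cell k 0 (0, []) []"
abbreviation cell_state :: "nat \<Rightarrow> cell" where "cell_state q \<equiv> Cell 0 q (0, []) []"
abbreviation cell_conf :: "nat \<times> nat list \<Rightarrow> cell" where "cell_conf v \<equiv> Cell 0 0 v []"
abbreviation cell_list :: "(nat \<times> nat list) list \<Rightarrow> cell" where "cell_list L \<equiv> Cell 0 0 (0, []) L"

context machine
begin

text \<open>The values of terms in the source (\<open>b = False\<close>) and in the target (\<open>b = True\<close>) reading.\<close>

definition reading :: "bool \<Rightarrow> nat \<Rightarrow> cell list \<Rightarrow> cell" where
  "reading b k as =
    (if k = 0 then cell_conf (cstate (hd as), map cnum (tl as))
     else if k = 1 then cell_list (cconf (as ! 0) # clist (as ! 1))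
     else if k = 2 then cell_num (Suc (cnum (as ! 0)))
     else if k = 3 then cell_list (if b then [] else [(qf, replicate K 0)])
     else if k = 4 then cell_list []
     else if k < 10 then cell_num (if b then after k else before k)
     else if even k then cell_state ((k - 10) div 2)
     else cell_state ((if b then snd else fst) (prod_decode ((k - 11) div 2))))"

text \<open>
  Sorts are numbers: an atom has its own symbol as its sort, numerals have sort 2, steps 5,
  configurations 6, and ill-formed terms 0.
\<close>

definition conf_sort :: "nat list \<Rightarrow> nat" where
  "conf_sort ns =
    (if \<exists>(q, kd, r, q') \<in> set R. ns = change q q' # (replicate K 2)[r := kd] then 5
     else if \<exists>q \<in> set (qf # map fst R). ns = state q # replicate K 2 then 6 else 0)"

definition sorting :: "nat \<Rightarrow> cell list \<Rightarrow> cell" where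
  "sorting k as = cell_num
    (if k = 0 then conf_sort (map cnum as)
     else if k = 1 then (if map cnum as = [5, 3] then 3 else if map cnum as = [6, 4] then 4 else 0)
     else if k = 2 then (if cnum (as ! 0) \<in> {2, 7, 8} then cnum (as ! 0) else 0)
     else if k = 5 \<or> k = 6 then 0 else k)"

text \<open>What sort \<open>k\<close> promises about the source value \<open>x\<close> and the
  target value \<open>y\<close> of one and the same term; about the sort 0 of ill-formed terms
  nothing is claimed. \<open>L\<close> holds the sources without the final configuration that the
  end mark contributes.\<close>

definition coherent :: "nat \<Rightarrow> cell \<Rightarrow> cell \<Rightarrow> bool" where
  "coherent k x y \<longleftrightarrow>
    (k = 2 \<longrightarrow> cnum x = cnum y) \<and>
    (k \<in> {7, 8, 9} \<longrightarrow> (\<exists>j. cnum x = j + before k \<and> cnum y = j + after k \<and> (k = 9 \<longrightarrow> j = 0))) \<and>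
    (\<forall>q. k = state q \<longrightarrow> cstate x = q \<and> cstate y = q) \<and>
    (\<forall>q q'. k = change q q' \<longrightarrow> cstate x = q \<and> cstate y = q') \<and>
    (k = 5 \<longrightarrow> mstep R K (cconf x) (cconf y)) \<and>
    (k = 6 \<longrightarrow> cconf x = cconf y) \<and>
    (k = 3 \<longrightarrow> (\<exists>L. clist x = L @ [(qf, replicate K 0)] \<and> list_all2 (mstep R K) L (clist y))) \<and>
    (k = 4 \<longrightarrow> clist x = clist y)"

definition sort_model :: "nat \<Rightarrow> cell fo_structure" where
  "sort_model l = copy_structure l (cell_num 2) sorting"
definition read_model :: "bool \<Rightarrow> nat \<Rightarrow> cell fo_structure" where
  "read_model b l = copy_structure l (cell_num 0) (reading b)"

section \<open>Sorts force the two readings to form machine steps\<close>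

lemma state_neq_change: "state q \<noteq> change p p'"
  by presburger

text \<open>Only register \<open>r\<close> is marked; the others have sort 2 and therefore agree in
  both readings.\<close>

lemma coherent_step:
  assumes rule: "(q, kd, r, q') \<in> set R"
    and len: "length ks = length xs" "length ks = length ys"
    and coh: "\<And>i. i < length ks \<Longrightarrow> coherent (ks ! i) (xs ! i) (ys ! i)"
    and ks: "ks = change q q' # (replicate K 2)[r := kd]"
  shows "mstep R K (cstate (hd xs), map cnum (tl xs)) (cstate (hd ys), map cnum (tl ys))"
proof -
  have "length xs = Suc K" "length ys = Suc K" using len by (simp_all add: ks)
  then obtain x xs' y ys' where xy: "xs = x # xs'" "ys = y # ys'" and len': "length xs' = K" "length ys' = K"
    by (auto simp: length_Suc_conv)
  have r: "r < K" and kd: "kd \<in> {7, 8, 9}" using rules[OF rule] by auto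
  have "coherent (change q q') x y" using coh[of 0] by (simp add: xy ks)
  then have st: "cstate x = q" "cstate y = q'" by (auto simp: coherent_def)
  have coh': "coherent ((replicate K 2)[r := kd] ! i) (xs' ! i) (ys' ! i)" if "i < K" for i
    using coh[of "Suc i"] that by (simp add: xy ks)
  from coh'[OF r] r kd obtain j where j: "cnum (xs' ! r) = j + before kd" "cnum (ys' ! r) = j + after kd"
    "kd = 9 \<longrightarrow> j = 0" by (auto simp: coherent_def)
  have other: "cnum (xs' ! i) = cnum (ys' ! i)" if "i < K" "i \<noteq> r" for i
    using coh'[OF that(1)] that by (simp add: coherent_def)
  define ms where "ms = (map cnum xs')[r := j]"
  have "map cnum xs' = ms[r := ms ! r + before kd]" "map cnum ys' = ms[r := ms ! r + after kd]"
    using j other r len' by (auto simp: ms_def list_eq_iff_nth_eq nth_list_update)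
  moreover have "length ms = K" "kd = 9 \<longrightarrow> ms ! r = 0" using j len' r by (auto simp: ms_def)
  ultimately show ?thesis unfolding mstep_def using rule st
    by (intro exI[of _ q] exI[of _ kd] exI[of _ r] exI[of _ q'] exI[of _ ms]) (simp add: xy)
qed

lemma coherent_conf:
  assumes len: "length ks = length xs" "length ks = length ys"
    and coh: "\<And>i. i < length ks \<Longrightarrow> coherent (ks ! i) (xs ! i) (ys ! i)"
    and ks: "ks = state q # replicate K 2"
  shows "(cstate (hd xs), map cnum (tl xs)) = (cstate (hd ys), map cnum (tl ys))"
proof -
  have "length xs = Suc K" "length ys = Suc K" using len by (simp_all add: ks)
  then obtain x xs' y ys' where xy: "xs = x # xs'" "ys = y # ys'" and len': "length xs' = K" "length ys' = K"
    by (auto simp: length_Suc_conv)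
  have "coherent (state q) x y" using coh[of 0] by (simp add: xy ks)
  then have "cstate x = q" "cstate y = q" by (auto simp: coherent_def)
  moreover have "cnum (xs' ! i) = cnum (ys' ! i)" if "i < K" for i
    using coh[of "Suc i"] that by (simp add: xy ks coherent_def)
  ultimately show ?thesis using len' by (auto simp: xy list_eq_iff_nth_eq)
qed

text \<open>Solutions are arbitrary terms, so every symbol must be shown to preserve
  coherence.\<close>

lemma coherent_val:
  "coherent (cnum (val (sort_model l) (\<lambda>_. cell_num 2) t)) (val (read_model False l) (\<lambda>_. cell_num 0) t)
    (val (read_model True l) (\<lambda>_. cell_num 0) t)"
proof (induction t)
  case (Var x)
  show ?case by (simp add: coherent_def)
next
  case (Fun i ts)
  show ?case
  proof (cases "ts = [] \<or> fst (prod_decode i) \<noteq> l")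
    case True
    \<comment> \<open>Constants and symbols of other copies act as the numeral zero in all three
      models: sort 2, and value 0 in both readings.\<close>
    then show ?thesis unfolding sort_model_def read_model_def val_copy_Fun by (simp add: coherent_def)
  next
    case False
    define k where "k = snd (prod_decode i)"
    define cs where "cs = map (val (sort_model l) (\<lambda>_. cell_num 2)) ts"
    define xs where "xs = map (val (read_model False l) (\<lambda>_. cell_num 0)) ts"
    define ys where "ys = map (val (read_model True l) (\<lambda>_. cell_num 0)) ts"
    have len: "length (map cnum cs) = length xs" "length (map cnum cs) = length ys"
      by (simp_all add: cs_def xs_def ys_def)
    have coh: "coherent (map cnum cs ! i) (xs ! i) (ys ! i)" if "i < length (map cnum cs)" for i
      using Fun.IH that by (simp add: cs_def xs_def ys_def)
    have ne: "cs \<noteq> []" using False by (simp add: cs_def)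
    have "coherent (cnum (sorting k cs)) (reading False k xs) (reading True k ys)"
    proof -
      consider "k = 0" | "k = 1" | "k = 2" | "k = 3" | "k = 4" | "k \<in> {5, 6}" | "k \<in> {7, 8, 9}" | "k \<ge> 10"
        by fastforce
      then show ?thesis
      proof cases
        case 1
        consider "conf_sort (map cnum cs) = 5" | "conf_sort (map cnum cs) = 6" | "conf_sort (map cnum cs) = 0"
          unfolding conf_sort_def by presburger
        then show ?thesis
        proof cases
          case a: 1
          then obtain q kd r q' where "(q, kd, r, q') \<in> set R"
            "map cnum cs = change q q' # (replicate K 2)[r := kd]"
            unfolding conf_sort_def by (auto split: if_splits)
          from coherent_step[OF this(1) len coh this(2)] a 1 show ?thesis
            by (simp add: sorting_def reading_def coherent_def)
        next
          case b: 2
          then obtain q where "map cnum cs = state q # replicate K 2"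
            unfolding conf_sort_def by (auto split: if_splits)
          from coherent_conf[OF len coh this] b 1 show ?thesis
            by (simp add: sorting_def reading_def coherent_def)
        next
          case 3
          with 1 show ?thesis by (simp add: sorting_def coherent_def)
        qed
      next
        case 2
        consider "map cnum cs = [5, 3]" | "map cnum cs = [6, 4]"
          | "map cnum cs \<noteq> [5, 3]" "map cnum cs \<noteq> [6, 4]" by blast
        then show ?thesis
        proof cases
          case a: 1
          then have "length (map cnum cs) = 2" by simp
          then have "coherent 5 (xs ! 0) (ys ! 0)" "coherent 3 (xs ! 1) (ys ! 1)"
            using coh[of 0] coh[of 1] a by (auto simp del: length_map)
          with a 2 show ?thesis by (auto simp: sorting_def reading_def coherent_def)
        next
          case b: 2
          then have "length (map cnum cs) = 2" by simp
          then have "coherent 6 (xs ! 0) (ys ! 0)" "coherent 4 (xs ! 1) (ys ! 1)"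
            using coh[of 0] coh[of 1] b by (auto simp del: length_map)
          with b 2 show ?thesis by (auto simp: sorting_def reading_def coherent_def)
        next
          case 3
          with 2 show ?thesis by (simp add: sorting_def coherent_def)
        qed
      next
        case 3
        have coh0: "coherent (cnum (cs ! 0)) (xs ! 0) (ys ! 0)" using coh[of 0] ne by simp
        consider "cnum (cs ! 0) = 2" | "cnum (cs ! 0) \<in> {7, 8}" | "cnum (cs ! 0) \<notin> {2, 7, 8}"
          by blast
        then show ?thesis
        proof cases
          case a: 2
          then have k: "cnum (cs ! 0) \<noteq> 9" by auto
          have "\<exists>j. cnum (xs ! 0) = j + before (cnum (cs ! 0)) \<and> cnum (ys ! 0) = j + after (cnum (cs ! 0))"
            using coh0 a by (auto simp: coherent_def)
          \<comment> \<open>A successor above the mark 7 or 8 raises the common part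
            \<open>j\<close> in both readings.\<close>
          then obtain j where "Suc (cnum (xs ! 0)) = Suc j + before (cnum (cs ! 0))"
            "Suc (cnum (ys ! 0)) = Suc j + after (cnum (cs ! 0))" by auto
          with a k 3 show ?thesis unfolding sorting_def reading_def coherent_def by force
        qed (use 3 coh0 in \<open>simp_all add: sorting_def reading_def coherent_def\<close>)
      next
        case 4
        then show ?thesis by (simp add: sorting_def reading_def coherent_def)
      next
        case 5
        then show ?thesis by (simp add: sorting_def reading_def coherent_def)
      next
        case 6
        then show ?thesis by (auto simp: sorting_def coherent_def)
      next
        case 7
        then show ?thesis by (auto simp: sorting_def reading_def coherent_def)
      next
        case 8
        then show ?thesis by (auto simp: sorting_def reading_def coherent_def)
      qed
    qed
    with False show ?thesis
      unfolding sort_model_def read_model_def val_copy_Fun k_def cs_def xs_def ys_def by simp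
  qed
qed

text \<open>Shifted pairing: the equation makes \<open>L\<close> and \<open>L'\<close> the same
  sequence without its last and without its first member, so \<open>P\<close> relates consecutive
  members.\<close>

lemma list_all2_step_imp_rtranclp:
  assumes "list_all2 P L L'" "L @ [y] = x # L'"
  shows "P\<^sup>*\<^sup>* x y"
  using assms
proof (induction L L' arbitrary: x rule: list_all2_induct)
  case (Cons a L b L')
  then have "P\<^sup>*\<^sup>* b y" "P x b" by auto
  then show ?case by (rule converse_rtranclp_into_rtranclp[rotated])
qed auto

lemmas val_defs = atom_def tcfg_def tcons_def tsuc_def

section \<open>The three models satisfy the hypotheses of the constraints\<close>

lemma eqs_sort_model: "eqs (sort_model l) e (sort_eqs l)"
proof -
  have 1: "conf_sort (change q q' # (replicate K 2)[r := kd]) = 5" if "(q, kd, r, q') \<in> set R" for q kd r q'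
  proof -
    have "\<exists>(p, kd', r', p') \<in> set R. change q q' # (replicate K 2)[r := kd] = change p p' # (replicate K 2)[r' := kd']"
      by (rule bexI[OF _ that]) simp
    then show ?thesis unfolding conf_sort_def by (rule if_P)
  qed
  \<comment> \<open>The parity of the head symbol keeps configurations out of the first
    branch.\<close>
  have 2: "conf_sort (state q # replicate K 2) = 6" if "q \<in> set (qf # map fst R)" for q
    using that state_neq_change[of q] unfolding conf_sort_def by (auto split: if_splits)
  have kd: "kd \<noteq> 5 \<and> kd \<noteq> 6 \<and> kd > 2" if "(q, kd, r, q') \<in> set R" for q kd r q'
    using rules[OF that] by auto
  let ?v = "val (sort_model l) e"
  have "?v (tsuc l (Const c)) = ?v (Const c)" "?v (tsuc l (atom l 7)) = ?v (atom l 7)"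
    "?v (tsuc l (atom l 8)) = ?v (atom l 8)"
    by (simp_all add: sort_model_def val_defs FunI_copy sorting_def)
  moreover have "?v (tcons l (tcfg l (atom l (change q q') # (replicate K (Const c))[r := atom l kd])) (atom l 3))
      = ?v (atom l 3)" if "(q, kd, r, q') \<in> set R" for q kd r q'
    using 1[OF that] kd[OF that]
    by (simp add: sort_model_def val_defs FunI_copy sorting_def map_update map_replicate_const)
  moreover have conf: "?v (tcons l (tcfg l (atom l (state q) # replicate K (Const c))) (atom l 4)) = ?v (atom l 4)"
    if "q \<in> set (qf # map fst R)" for q
    using 2[OF that] by (simp add: sort_model_def val_defs FunI_copy sorting_def map_replicate_const)
  moreover have "?v (tcons l (tcfg l (atom l (state q) # replicate K (Const c))) (atom l 4)) = ?v (atom l 4)"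
    if "(q, kd, r, q') \<in> set R" for q kd r q'
    by (rule conf) (use that in force)
  ultimately show ?thesis unfolding eqs_def sort_eqs_def by auto
qed

lemma eqs_read_model:
  "eqs (read_model False l) e (source_eqs l)" "eqs (read_model True l) e (target_eqs l)"
  unfolding eqs_def source_eqs_def target_eqs_def read_model_def val_defs final_def
  by (auto simp: FunI_copy reading_def before_def after_def map_replicate_const)

lemma val_num: "cnum (val (read_model b l) e (num l m)) = m"
  unfolding shift_def
  by (induction m) (auto simp: read_model_def val_defs FunI_copy reading_def)

text \<open>If the terms satisfied the input equation and all constraints of copy \<open>l\<close>
  in every such structure, they would do so in the three models above, and an accepting run on
  \<open>m\<close> could be read off from their values.\<close>

lemma falsifying_copy:
  assumes "\<not> accepts m"
  obtains d :: cell and F where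
    "val (copy_structure l d F) (\<lambda>_. d) (\<tau> (3 * l)) \<noteq> val (copy_structure l d F) (\<lambda>_. d) (num l m) \<or>
     (\<exists>(E, s, t) \<in> set (constraints l).
       eqs (copy_structure l d F) (\<lambda>x. val (copy_structure l d F) (\<lambda>_. d) (\<tau> x)) E \<and>
       val (copy_structure l d F) (\<lambda>x. val (copy_structure l d F) (\<lambda>_. d) (\<tau> x)) s \<noteq>
       val (copy_structure l d F) (\<lambda>x. val (copy_structure l d F) (\<lambda>_. d) (\<tau> x)) t)"
proof (rule ccontr)
  assume neg: "\<not> thesis"
  have sol: "val (copy_structure l d F) (\<lambda>_. d) (\<tau> (3 * l)) = val (copy_structure l d F) (\<lambda>_. d) (num l m)"
    "\<And>E s t. (E, s, t) \<in> set (constraints l) \<Longrightarrow>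
       eqs (copy_structure l d F) (\<lambda>x. val (copy_structure l d F) (\<lambda>_. d) (\<tau> x)) E \<Longrightarrow>
       val (copy_structure l d F) (\<lambda>x. val (copy_structure l d F) (\<lambda>_. d) (\<tau> x)) s =
       val (copy_structure l d F) (\<lambda>x. val (copy_structure l d F) (\<lambda>_. d) (\<tau> x)) t"
    for d :: cell and F
    using neg that[of d F] by blast+
  let ?S = "val (sort_model l) (\<lambda>_. cell_num 2)"
  let ?A = "val (read_model False l) (\<lambda>_. cell_num 0)"
  let ?B = "val (read_model True l) (\<lambda>_. cell_num 0)"
  let ?W = "\<tau> (3 * l + 1)" and ?Y = "\<tau> (3 * l + 2)"
  \<comment> \<open>Each model satisfies one system of equations, so the constraints with this
    system as hypothesis become identities between values.\<close>
  note S = sol(2)[of _ _ _ "cell_num 2" sorting, folded sort_model_def, OF _ eqs_sort_model]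
  note A = sol(2)[of _ _ _ "cell_num 0" "reading False", folded read_model_def, OF _ eqs_read_model(1)]
  note B = sol(2)[of _ _ _ "cell_num 0" "reading True", folded read_model_def, OF _ eqs_read_model(2)]
  have inp: "cnum (?B (\<tau> (3 * l))) = m"
    using sol(1)[of "cell_num 0" "reading True"] val_num unfolding read_model_def by metis
  have "?S ?W = cell_num 3"
    using S[of "Var (3 * l + 1)" "atom l 3"]
    by (simp add: constraints_def) (simp add: sort_model_def val_defs FunI_copy sorting_def)
  with coherent_val[of l ?W] obtain L where L: "clist (?A ?W) = L @ [(qf, replicate K 0)]"
    "list_all2 (mstep R K) L (clist (?B ?W))" by (auto simp: coherent_def)
  have "?S ?Y = cell_num 4"
    using S[of "Var (3 * l + 2)" "atom l 4"]
    by (simp add: constraints_def) (simp add: sort_model_def val_defs FunI_copy sorting_def)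
  with coherent_val[of l ?Y] have Y: "clist (?A ?Y) = clist (?B ?Y)" by (simp add: coherent_def)
  have 1: "?A ?W = ?A ?Y"
    using A[of "Var (3 * l + 1)" "Var (3 * l + 2)"] by (simp add: constraints_def)
  have "?B ?Y = val (read_model True l) (\<lambda>x. ?B (\<tau> x))
      (tcons l (tcfg l (atom l (state q0) # Var (3 * l) # replicate (K - 1) (Const c))) (Var (3 * l + 1)))"
    using B[of "tcons l (tcfg l (atom l (state q0) # Var (3 * l) # replicate (K - 1) (Const c)))
      (Var (3 * l + 1))" "Var (3 * l + 2)"] by (simp add: constraints_def)
  also have "\<dots> = cell_list ((q0, m # replicate (K - 1) 0) # clist (?B ?W))"
    using inp unfolding read_model_def val_defs
    by (simp add: FunI_copy reading_def map_replicate_const)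
  \<comment> \<open>By its sort \<open>?Y\<close> has the same list in both readings. This
    identifies the source list of \<open>?W\<close> with the initial configuration followed by its
    target list.\<close>
  finally have "L @ [(qf, replicate K 0)] = (q0, m # replicate (K - 1) 0) # clist (?B ?W)"
    using L(1) Y 1 by simp
  from list_all2_step_imp_rtranclp[OF L(2) this] assms show False by blast
qed

end

section \<open>Locality of the copies; variables and unknowns of the matrix\<close>

context machine
begin

text \<open>The hypotheses of copy \<open>l\<close> are ground, and in a structure of another copy
  both sides denote the default \<open>d\<close>. So the components of the product do not disturb
  each other.\<close>

lemma constraint_eqs_local:
  assumes "(E, s, t) \<in> set (constraints l)" "(a, b) \<in> set E"
  shows "admissible a \<and> admissible b"
    and "l' \<noteq> l \<Longrightarrow> val (copy_structure l' d F) e a = d \<and> val (copy_structure l' d F) e b = d"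
proof -
  have regs: "admissible u" if "u \<in> set ((replicate K (Const c))[r := atom l kd])" for u r kd
    using set_update_subset_insert[THEN subsetD, OF that] by (auto simp: admissible_const admissible_atom)
  have "admissible (final l)" "admissible (tsuc l u)" if "admissible u" for u
    unfolding final_def tsuc_def using that
    by (auto intro!: admissible_tcfg admissible_Fun admissible_atom simp: admissible_const)
  note adm = this(1)[OF admissible_const] this(2) admissible_const admissible_atom
  show "admissible a \<and> admissible b"
    using assms regs unfolding constraints_def sort_eqs_def source_eqs_def target_eqs_def
    by (auto intro!: admissible_tcons admissible_tcfg adm simp: adm)
  show "val (copy_structure l' d F) e a = d \<and> val (copy_structure l' d F) e b = d" if "l' \<noteq> l"
    using assms that unfolding constraints_def sort_eqs_def source_eqs_def target_eqs_def
    by (auto simp: FunI_copy val_defs)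
qed

lemma qfree_matrix: "qfree (Conj (inputs c n m) (matrix n))"
  by (auto simp: inputs_def matrix_def qfree_conjs qfree_horn split: prod.splits)

lemma free_vars_constraint:
  assumes "(E, s, t) \<in> set (constraints l)"
  shows "free_vars (horn c E s t) \<subseteq> {3 * l, 3 * l + 1, 3 * l + 2}"
proof -
  have "vars_tm a = {} \<and> vars_tm b = {}" if "(a, b) \<in> set E" for a b
    using constraint_eqs_local(1)[OF assms that] by (simp add: admissible_def)
  then have "(\<Union>(a, b)\<in>set E. vars_tm a \<union> vars_tm b) = {}" by auto
  moreover have "vars_tm s \<union> vars_tm t \<subseteq> {3 * l, 3 * l + 1, 3 * l + 2}"
    using assms by (auto simp: constraints_def val_defs)
  ultimately show ?thesis unfolding free_vars_horn by simp
qed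

lemma unknowns_constraint:
  assumes "c \<notin> U" "(E, s, t) \<in> set (constraints l)"
  shows "unknowns U (horn c E s t) = {}"
proof -
  have "unknowns_tm U a = {} \<and> unknowns_tm U b = {}" if "(a, b) \<in> set E" for a b
    using constraint_eqs_local(1)[OF assms(2) that] assms(1) by (simp add: admissible_def)
  then have "(\<Union>(a, b)\<in>set E. unknowns_tm U a \<union> unknowns_tm U b) = {}" by auto
  moreover have "unknowns_tm U s \<union> unknowns_tm U t = {}"
    using assms by (auto simp: constraints_def val_defs)
  ultimately show ?thesis using assms(1) by (simp add: unknowns_horn)
qed

lemma admissible_num: "admissible (num l m)"
  by (rule admissible_shift[OF admissible_const])

lemma free_vars_matrix: "free_vars (Conj (inputs c n m) (matrix n)) \<subseteq> set [0..<3 * n]"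
proof -
  have "free_vars (inputs c n m) \<subseteq> set [0..<3 * n]"
    using admissible_num by (auto simp: inputs_def free_vars_conjs admissible_def)
  moreover have "free_vars (matrix n) \<subseteq> set [0..<3 * n]"
  proof
    fix x assume "x \<in> free_vars (matrix n)"
    then obtain l E s t where "l < n" "(E, s, t) \<in> set (constraints l)" "x \<in> free_vars (horn c E s t)"
      by (auto simp: matrix_def free_vars_conjs)
    then show "x \<in> set [0..<3 * n]" using free_vars_constraint by fastforce
  qed
  ultimately show ?thesis by simp
qed

lemma unknowns_matrix: "c \<notin> U \<Longrightarrow> unknowns U (Conj (inputs c n m) (matrix n)) = {}"
  using admissible_num unknowns_constraint
  by (fastforce simp: inputs_def matrix_def unknowns_conjs admissible_def)

section \<open>Acceptance and solvability of skeletons\<close>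

lemma sat_matrix:
  "sat M e (Conj (inputs c n m) (matrix n)) \<longleftrightarrow>
    (\<forall>l<n. e (3 * l) = val M e (num l m) \<and>
      (\<forall>(E, s, t) \<in> set (constraints l). eqs M e E \<longrightarrow> val M e s = val M e t))"
  by (fastforce simp: inputs_def matrix_def sat_conjs sat_horn)

lemma val_closed: "vars_tm t = {} \<Longrightarrow> val M e t = val M e' t"
proof (induction t)
  case (Fun i ts)
  then have "map (val M e) ts = map (val M e') ts" by auto
  then show ?case by (simp only: val.simps)
qed auto

lemma eqs_constraint_closed: "(E, s, t) \<in> set (constraints l) \<Longrightarrow> eqs M e E = eqs M e' E"
  using constraint_eqs_local(1) val_closed[of _ M e e'] unfolding eqs_def admissible_def by fastforce

lemma accepts_imp_Sk:
  assumes "infinite U" "c \<notin> U" "n \<ge> 1" "accepts m"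
  shows "Sk TYPE('a) U n (foldr Exi [0..<3 * n] (Conj (inputs c n m) (matrix n)))"
proof -
  let ?v = "(q0, m # replicate (K - 1) 0)"
  have "\<forall>l. \<exists>W Y. admissible W \<and> admissible Y \<and> (\<forall>(M :: 'a fo_structure) e.
    (eqs M e (sort_eqs l) \<longrightarrow> val M e W = val M e (atom l 3)) \<and>
    (eqs M e (source_eqs l) \<longrightarrow> val M e W = val M e Y) \<and>
    (eqs M e (target_eqs l) \<longrightarrow> val M e (tcons l (tconf l ?v) W) = val M e Y) \<and>
    (eqs M e (sort_eqs l) \<longrightarrow> val M e Y = val M e (atom l 4)))"
    using run_solves[OF assms(4)] by blast
  then obtain W Y where adm: "\<And>l. admissible (W l)" "\<And>l. admissible (Y l)"
    and sol: "\<And>l (M :: 'a fo_structure) e. eqs M e (sort_eqs l) \<Longrightarrow> val M e (W l) = val M e (atom l 3)"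
      "\<And>l (M :: 'a fo_structure) e. eqs M e (source_eqs l) \<Longrightarrow> val M e (W l) = val M e (Y l)"
      "\<And>l (M :: 'a fo_structure) e. eqs M e (target_eqs l) \<Longrightarrow>
        val M e (tcons l (tconf l ?v) (W l)) = val M e (Y l)"
      "\<And>l (M :: 'a fo_structure) e. eqs M e (sort_eqs l) \<Longrightarrow> val M e (Y l) = val M e (atom l 4)"
    by metis
  \<comment> \<open>The residue modulo 3 selects input, steps or configurations; the quotient is the
    copy. All copies receive the same run.\<close>
  define \<tau> where "\<tau> x = (if x mod 3 = 0 then num (x div 3) m
    else if x mod 3 = 1 then W (x div 3) else Y (x div 3))" for x
  have "(3 * l + 1) div 3 = l" "(3 * l + 1) mod 3 = 1" "(3 * l + 2) div 3 = l" "(3 * l + 2) mod 3 = 2"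
    for l :: nat by presburger+
  then have \<tau>: "\<tau> (3 * l) = num l m" "\<tau> (3 * l + 1) = W l" "\<tau> (3 * l + 2) = Y l" for l
    unfolding \<tau>_def by (simp_all only:) simp_all
  have adm\<tau>: "admissible (\<tau> x)" for x using adm admissible_num by (simp add: \<tau>_def)
  show ?thesis
  proof (rule instance_imp_Sk[OF assms(1) qfree_matrix unknowns_matrix[OF assms(2)] assms(3) _ free_vars_matrix])
    fix M :: "'a fo_structure" and e
    let ?e = "\<lambda>x. val M e (\<tau> x)"
    have closed: "val M ?e t = val M e t" if "admissible t" for t
      using that val_closed unfolding admissible_def by blast
    have "val M ?e s = val M ?e t"
      if con: "(E, s, t) \<in> set (constraints l)" and E: "eqs M ?e E" for l E s t
    proof -
      have E': "eqs M e E" using eqs_constraint_closed[OF con] E by blast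
      have tgt: "val M ?e (tcons l (tcfg l (atom l (state q0) # Var (3 * l) # replicate (K - 1) (Const c)))
          (Var (3 * l + 1))) = val M e (tcons l (tconf l ?v) (W l))"
        using \<tau>[of l] closed[OF admissible_atom]
        by (simp add: val_tcons val_tcfg tconf_def shift_def)
      from con consider "E = sort_eqs l" "s = Var (3 * l + 1)" "t = atom l 3"
        | "E = source_eqs l" "s = Var (3 * l + 1)" "t = Var (3 * l + 2)"
        | "E = target_eqs l" "s = tcons l (tcfg l (atom l (state q0) # Var (3 * l) # replicate (K - 1) (Const c)))
            (Var (3 * l + 1))" "t = Var (3 * l + 2)"
        | "E = sort_eqs l" "s = Var (3 * l + 2)" "t = atom l 4"
        unfolding constraints_def by auto
      then show ?thesis
      proof cases
        case 3
        then show ?thesis using tgt sol(3) E' \<tau> by simp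
      qed (use sol E' \<tau>[of l] closed[OF admissible_atom] in simp_all)
    qed
    then show "sat M ?e (Conj (inputs c n m) (matrix n))"
      unfolding sat_matrix using \<tau> closed[OF admissible_num] by auto
  qed (use adm\<tau> assms(2) in \<open>auto simp: admissible_def\<close>)
qed

text \<open>Copy \<open>i\<close> is played against the \<open>i\<close>-th disjunct: component
  \<open>i\<close> of the product refutes the instance \<open>\<tau> i\<close>, so no disjunct is
  true in the product.\<close>

lemma Sk_imp_accepts:
  assumes "infinite (UNIV :: 'a set)" "n \<ge> 1"
    and Sk: "Sk TYPE('a) U n (foldr Exi [0..<3 * n] (Conj (inputs c n m) (matrix n)))"
  shows "accepts m"
proof (rule ccontr)
  assume neg: "\<not> accepts m"
  obtain \<tau> :: "nat \<Rightarrow> nat \<Rightarrow> tm"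
    where \<tau>: "\<And>(M :: (nat \<Rightarrow> cell) fo_structure) e. is_structure M \<Longrightarrow> range e \<subseteq> Dom M \<Longrightarrow>
      \<exists>i<n. sat M (\<lambda>x. val M e (\<tau> i x)) (Conj (inputs c n m) (matrix n))"
    using Sk_imp_instances[OF Sk assms(1) qfree_matrix assms(2)] by blast
  define bad where "bad l N d \<longleftrightarrow> val N (\<lambda>_. d) (\<tau> l (3 * l)) \<noteq> val N (\<lambda>_. d) (num l m) \<or>
     (\<exists>(E, s, t) \<in> set (constraints l). eqs N (\<lambda>x. val N (\<lambda>_. d) (\<tau> l x)) E \<and>
       val N (\<lambda>x. val N (\<lambda>_. d) (\<tau> l x)) s \<noteq> val N (\<lambda>x. val N (\<lambda>_. d) (\<tau> l x)) t)"
    for l and N :: "cell fo_structure" and d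
  have "\<forall>l. \<exists>d F. bad l (copy_structure l d F) d"
    unfolding bad_def using falsifying_copy[OF neg] by metis
  then obtain d F where bad: "\<And>l. bad l (copy_structure l (d l) (F l)) (d l)" by metis
  define N where "N l = copy_structure l (d l) (F l)" for l
  define M where "M = product_structure N"
  let ?e = "\<lambda>_ :: nat. d"
  have "is_structure M" "range ?e \<subseteq> Dom M"
    by (simp_all add: M_def product_structure_def is_structure_def)
  then obtain i where "i < n" and sat: "sat M (\<lambda>x. val M ?e (\<tau> i x)) (Conj (inputs c n m) (matrix n))"
    using \<tau> by blast
  let ?r = "\<lambda>x. val M ?e (\<tau> i x)"
  have val: "val M ?r t l = val (N l) (\<lambda>x. val (N l) (\<lambda>_. d l) (\<tau> i x)) t" for t l
    by (simp add: M_def val_product)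
  have inp: "?r (3 * i) = val M ?r (num i m)"
    and con: "\<And>E s t. (E, s, t) \<in> set (constraints i) \<Longrightarrow> eqs M ?r E \<Longrightarrow> val M ?r s = val M ?r t"
    using sat \<open>i < n\<close> unfolding sat_matrix by blast+
  from bad[of i] consider "val (N i) (\<lambda>_. d i) (\<tau> i (3 * i)) \<noteq> val (N i) (\<lambda>_. d i) (num i m)"
    | E s t where "(E, s, t) \<in> set (constraints i)" "eqs (N i) (\<lambda>x. val (N i) (\<lambda>_. d i) (\<tau> i x)) E"
      "val (N i) (\<lambda>x. val (N i) (\<lambda>_. d i) (\<tau> i x)) s \<noteq> val (N i) (\<lambda>x. val (N i) (\<lambda>_. d i) (\<tau> i x)) t"
    unfolding bad_def N_def[symmetric] by blast
  then show False
  proof cases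
    case 1
    have "val (N i) e (num i m) = val (N i) e' (num i m)" for e e'
      using val_closed admissible_num unfolding admissible_def by blast
    moreover have "?r (3 * i) i = val (N i) (\<lambda>_. d i) (\<tau> i (3 * i))"
      by (simp add: M_def val_product)
    ultimately show False using 1 fun_cong[OF inp, of i] val by metis
  next
    case 2
    \<comment> \<open>The hypotheses hold in component \<open>i\<close> by its choice, and in the
      others because both sides are the default.\<close>
    have "val M ?r a = val M ?r b" if ab: "(a, b) \<in> set E" for a b
    proof
      fix l
      show "val M ?r a l = val M ?r b l"
      proof (cases "l = i")
        case True
        then show ?thesis unfolding val using 2(2) ab by (auto simp: eqs_def)
      next
        case False
        then show ?thesis unfolding val N_def using constraint_eqs_local(2)[OF 2(1) ab] by metis
      qed
    qed
    then have "eqs M ?r E" by (auto simp: eqs_def)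
    from fun_cong[OF con[OF 2(1) this], of i] 2(3) show False unfolding val by blast
  qed
qed

end

section \<open>Diagonalisation\<close>

text \<open>The code of the existential closure with input \<open>a\<close>, assembled from the code
  \<open>a\<close> of the matrix without decoding it; 7 and 3 are the tags of \<open>Exi\<close> and
  \<open>Conj\<close>.\<close>

definition diagonal :: "nat \<Rightarrow> nat \<Rightarrow> nat \<Rightarrow> nat" where
  "diagonal c n a = foldr (\<lambda>x r. prod_encode (7, prod_encode (x, r))) [0..<3 * n]
     (prod_encode (3, prod_encode (code_fm (inputs c n a), a)))"

lemma code_foldr_Exi:
  "code_fm (foldr Exi xs A) = foldr (\<lambda>x r. prod_encode (7, prod_encode (x, r))) xs (code_fm A)"
  by (induction xs) auto

lemma diagonal_code:
  "diagonal c n (code_fm A) = code_fm (foldr Exi [0..<3 * n] (Conj (inputs c n (code_fm A)) A))"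
  by (simp add: diagonal_def code_foldr_Exi)

lemma recursive_fun_code_shift:
  assumes "recursive_fun k g"
  shows "recursive_fun k (\<lambda>xs. code_tm (shift l (g xs) t))"
proof -
  \<comment> \<open>One application of \<open>tsuc\<close> on codes:
    \<open>Suc (prod_encode (x, 0))\<close> codes the one-element list of arguments.\<close>
  let ?s = "\<lambda>xs. prod_encode (1, prod_encode (prod_encode (l, 2), Suc (prod_encode (xs ! 1, 0))))"
  have "recursive_fun 2 ?s"
    by (intro recursive_fun_prod_encode recursive_fun_Suc recursive_fun_const recursive_fun.proj) auto
  from recursive_fun_iterate[OF this assms, of "code_tm t"]
  have "recursive_fun k (\<lambda>xs. rec_nat (code_tm t) (\<lambda>m r. ?s [m, r]) (g xs))" .
  moreover have "rec_nat (code_tm t) (\<lambda>m r. ?s [m, r]) j = code_tm (shift l j t)" for j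
    by (induction j) (auto simp: shift_def tsuc_def)
  ultimately show ?thesis by simp
qed

lemma recursive_fun_code_inputs:
  assumes "recursive_fun k g"
  shows "recursive_fun k (\<lambda>xs. code_fm (inputs c n (g xs)))"
proof -
  have "recursive_fun k (\<lambda>xs. code_fm (conjs c (map (\<lambda>l. Eql (Var (3 * l)) (shift l (g xs) (Const c))) ls)))"
    for ls
    by (induction ls)
      (auto intro!: recursive_fun_prod_encode recursive_fun_const recursive_fun_code_shift assms)
  then show ?thesis by (simp add: inputs_def)
qed

lemma recursive_fun_diagonal: "recursive_fun 1 (\<lambda>xs. diagonal c n (xs ! 0))"
proof -
  have foldr: "recursive_fun k (\<lambda>xs. foldr (\<lambda>x r. prod_encode (7, prod_encode (x, r))) ls (g xs))"
    if "recursive_fun k g" for k ls g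
    by (induction ls) (auto intro!: recursive_fun_prod_encode recursive_fun_const that)
  show ?thesis unfolding diagonal_def
    by (intro foldr recursive_fun_prod_encode recursive_fun_const recursive_fun_code_inputs
        recursive_fun.proj) simp_all
qed

theorem mainTheorem1:
  fixes U :: "nat set" and n :: nat
  assumes "infinite U" and "U \<noteq> UNIV"
    and "infinite (UNIV :: 'a set)"
    and "n \<ge> 1"
  shows "\<not> recursive_fm_pred (Sk TYPE('a) U n)"
proof
  assume "recursive_fm_pred (Sk TYPE('a) U n)"
  then obtain f where f: "recursive_fun 1 f"
    "\<And>m. f [m] = (if \<exists>A. m = code_fm A \<and> Sk TYPE('a) U n A then 1 else 0)"
    unfolding recursive_fm_pred_def recursive_pred_def by blast
  have code: "f [code_fm A] = 0 \<longleftrightarrow> \<not> Sk TYPE('a) U n A" for A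
    using f(2) code_fm_inj by auto
  \<comment> \<open>A constant outside the unknowns serves as zero, so the matrix contains no
    unknowns.\<close>
  obtain c where c: "c \<notin> U" using assms(2) by blast
  have "recursive_fun 1 (\<lambda>xs. f [diagonal c n (xs ! 0)])"
    by (rule recursive_fun_comp1[OF f(1) recursive_fun_diagonal])
  then obtain R K q0 qf where "0 < K" "\<And>q kd r q'. (q, kd, r, q') \<in> set R \<Longrightarrow> r < K \<and> kd \<in> {7, 8, 9}"
    and acc: "\<And>m. (mstep R K)\<^sup>*\<^sup>* (q0, m # replicate (K - 1) 0) (qf, replicate K 0) \<longleftrightarrow>
      f [diagonal c n ([m] ! 0)] = 0"
    by (rule recursive_fun_machine) blast
  then interpret machine c K q0 qf R by unfold_locales
  \<comment> \<open>The machine built from \<open>f\<close> is given the code of its own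
    matrix.\<close>
  let ?a = "code_fm (matrix n)"
  let ?\<psi> = "foldr Exi [0..<3 * n] (Conj (inputs c n ?a) (matrix n))"
  have "accepts ?a \<longleftrightarrow> \<not> Sk TYPE('a) U n ?\<psi>"
    using acc[of ?a] code by (simp add: diagonal_code)
  moreover have "accepts ?a \<longleftrightarrow> Sk TYPE('a) U n ?\<psi>"
    using accepts_imp_Sk[OF assms(1) c assms(4)] Sk_imp_accepts[OF assms(3,4)] by blast
  ultimately show False by blast
qed

end
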